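(* Let $G$ be a second-countable locally compact non-compact group, $S\subset G$, $1\le p<+\infty$, let $\Gamma\subset\mathbb{C}$ be such that $\Gamma\setminus\{0\}$ is non-empty, and let $\omega$ be a locally $p$-integrable $S$-admissible weight on $G$. If $\omega$ is continuous and for every $s\in G$ $$M(s):=\sup_{t\in G}\frac{\omega(st)}{\omega(t)}<+\infty\quad\text{and}\quad R(s):=\sup_{t\in G}\frac{\omega(ts)}{\omega(t)}<+\infty,$$ then the following hold: (1) If $\Gamma\setminus\{0\}$ is bounded and bounded away from zero, there is a $(\Gamma,S)$-dense vector in $L^p(G,\omega)$ if and only if $\inf_{s\in S}\max\{\omega(s);\omega(s^{-1})\}=0$. (2) There is a $([0,1],S)$-dense vector in $L^p(G,\omega)$ if and only if $\inf_{s\in S}\max\{\omega(s)\omega(s^{-1});\omega(s^{-1})\}=0$. (3) There is a $([1,+\infty),S)$-dense vector in $L^p(G,\omega)$ if and only if $\inf_{s\in S}\max\{\omega(s)\omega(s^{-1});\omega(s)\}=0$. (4) There is a $(\mathbb{C},S)$-dense vector in $L^p(G,\omega)$ if and only if $\inf_{s\in S}\omega(s)\,\omega(s^{-1})=0$.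
   Context: Let $\mu$ be a left Haar measure on $G$. A weight on $G$ is a positive measurable function $\omega:G\to(0,+\infty)$; it is locally $p$-integrable if $\int_K\omega^p\,d\mu<+\infty$ for every compact $K\subset G$. $L^p(G,\omega)$ is the space of measurable $f:G\to\mathbb{C}$ (modulo a.e. equality) with $\|f\|_{p,\omega}:=\left(\int_G|f(t)|^p\omega(t)^p\,d\mu(t)\right)^{1/p}<\infty$, with this norm. For $s\in G$, the left translation is $(T_sf)(t)=f(s^{-1}t)$. The weight $\omega$ is $S$-admissible if $\operatorname{ess\,sup}_{t\in G}\omega(st)/\omega(t)<+\infty$ for all $s\in S$ (equivalently, $T_s$ is a bounded operator of $L^p(G,\omega)$ into itself for every $s\in S$). For $\Lambda\subset\mathbb{C}$, a vector $f\in L^p(G,\omega)$ is $(\Lambda,S)$-dense if $\{\lambda T_sf:\ \lambda\in\Lambda,\ s\in S\}$ is dense in $L^p(G,\omega)$. *)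

theory Defs
  imports "HOL-Probability.Essential_Supremum"
begin

text \<open>
  Groups are written additively, using the library class \<open>topological_group_add\<close>, which does
  \<^emph>\<open>not\<close> assume commutativity: \<open>s + t\<close> is the product \<open>st\<close> and \<open>- s\<close> is \<open>s\<inverse>\<close>.
\<close>

definition left_haar_measure :: "'a :: topological_group_add measure \<Rightarrow> bool" where
  "left_haar_measure \<mu> \<longleftrightarrow>
     sets \<mu> = sets borel \<and>
     emeasure \<mu> (space \<mu>) \<noteq> 0 \<and>
     (\<forall>K. compact K \<longrightarrow> emeasure \<mu> K < \<infinity>) \<and>
     (\<forall>A\<in>sets borel. emeasure \<mu> A = (INF U\<in>{U. open U \<and> A \<subseteq> U}. emeasure \<mu> U)) \<and>
     (\<forall>U. open U \<longrightarrow> emeasure \<mu> U = (SUP K\<in>{K. compact K \<and> K \<subseteq> U}. emeasure \<mu> K)) \<and>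
     (\<forall>s. \<forall>A\<in>sets borel. emeasure \<mu> ((+) s ` A) = emeasure \<mu> A)"

definition weight :: "'a measure \<Rightarrow> ('a \<Rightarrow> real) \<Rightarrow> bool" where
  "weight \<mu> \<omega> \<longleftrightarrow> \<omega> \<in> borel_measurable \<mu> \<and> (\<forall>t. 0 < \<omega> t)"

definition locally_p_integrable ::
    "'a :: topological_space measure \<Rightarrow> real \<Rightarrow> ('a \<Rightarrow> real) \<Rightarrow> bool" where
  "locally_p_integrable \<mu> p \<omega> \<longleftrightarrow>
     (\<forall>K. compact K \<longrightarrow> (\<integral>\<^sup>+t\<in>K. ennreal (\<omega> t powr p) \<partial>\<mu>) < \<infinity>)"

definition admissible_weight ::
    "'a :: group_add measure \<Rightarrow> 'a set \<Rightarrow> ('a \<Rightarrow> real) \<Rightarrow> bool" where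
  "admissible_weight \<mu> S \<omega> \<longleftrightarrow>
     (\<forall>s\<in>S. esssup \<mu> (\<lambda>t. ennreal (\<omega> (s + t) / \<omega> t)) < \<infinity>)"

text \<open>
  Elements of $L^p(G,\omega)$ are represented by functions. The passage to classes modulo equality
  almost everywhere is left implicit: \<open>weighted_Lp_norm\<close> is a seminorm on \<open>weighted_Lp\<close>, and density
  of a set of functions below is density of the set of their classes in the quotient.
\<close>

definition weighted_Lp :: "'a measure \<Rightarrow> real \<Rightarrow> ('a \<Rightarrow> real) \<Rightarrow> ('a \<Rightarrow> complex) set" where
  "weighted_Lp \<mu> p \<omega> =
     {f \<in> borel_measurable \<mu>. (\<integral>\<^sup>+t. ennreal (norm (f t) powr p * \<omega> t powr p) \<partial>\<mu>) < \<infinity>}"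

text \<open>The value below is meaningful only on \<open>weighted_Lp\<close>, since \<open>enn2real \<infinity> = 0\<close>.\<close>

definition weighted_Lp_norm :: "'a measure \<Rightarrow> real \<Rightarrow> ('a \<Rightarrow> real) \<Rightarrow> ('a \<Rightarrow> complex) \<Rightarrow> real" where
  "weighted_Lp_norm \<mu> p \<omega> f =
     enn2real (\<integral>\<^sup>+t. ennreal (norm (f t) powr p * \<omega> t powr p) \<partial>\<mu>) powr (1 / p)"

definition dense_in_weighted_Lp ::
    "'a measure \<Rightarrow> real \<Rightarrow> ('a \<Rightarrow> real) \<Rightarrow> ('a \<Rightarrow> complex) set \<Rightarrow> bool" where
  "dense_in_weighted_Lp \<mu> p \<omega> D \<longleftrightarrow>
     D \<subseteq> weighted_Lp \<mu> p \<omega> \<and>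
     (\<forall>g\<in>weighted_Lp \<mu> p \<omega>. \<forall>\<epsilon>>0. \<exists>h\<in>D. weighted_Lp_norm \<mu> p \<omega> (\<lambda>t. h t - g t) < \<epsilon>)"

definition left_translation :: "'a :: group_add \<Rightarrow> ('a \<Rightarrow> complex) \<Rightarrow> 'a \<Rightarrow> complex" where
  "left_translation s f = (\<lambda>t. f (- s + t))"

definition dense_vector ::
    "'a :: group_add measure \<Rightarrow> real \<Rightarrow> ('a \<Rightarrow> real) \<Rightarrow> complex set \<Rightarrow> 'a set
      \<Rightarrow> ('a \<Rightarrow> complex) \<Rightarrow> bool" where
  "dense_vector \<mu> p \<omega> \<Lambda> S f \<longleftrightarrow>
     f \<in> weighted_Lp \<mu> p \<omega> \<and>
     dense_in_weighted_Lp \<mu> p \<omega> {(\<lambda>t. c * left_translation s f t) | c s. c \<in> \<Lambda> \<and> s \<in> S}"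

end

theory Submission
  imports Defs
begin

text \<open>
  Put \<open>P(\<Lambda>)\<close> for: every \<open>\<epsilon> > 0\<close> admits \<open>s \<in> S\<close> and \<open>c \<in> \<Lambda>\<close> with \<open>|c| \<omega>(s) < \<epsilon>\<close> and
  \<open>\<omega>(-s) < \<epsilon> |c|\<close>. For each of the four scalar sets, elementary algebra turns the condition on the
  infimum into \<open>P(\<Lambda>)\<close>; so everything rests on showing that \<open>P(\<Lambda>)\<close> is equivalent to the existence of
  a \<open>(\<Lambda>, S)\<close>-dense vector. By Baire category the finite submultiplicative functions \<open>M\<close> and \<open>R\<close> are
  bounded on compact sets.

  If \<open>f\<close> is dense, approximate the indicator of a fixed compact set \<open>K\<close>, perturbed by a small multiple
  of the indicator of a far translate of \<open>K\<close>, by some \<open>c T\<^sub>s f\<close>. As \<open>T\<^sub>s f\<close> has uniformly small tails for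
  \<open>s\<close> in a compact set \<open>Q\<close>, the perturbation forces \<open>s \<notin> Q\<close>. Then \<open>-s + K\<close> lies in the tail of \<open>f\<close>, so that
  \<open>\<omega>(-s)/|c|\<close> is small, while \<open>c T\<^sub>s\<close> moves a compact part of the mass of \<open>f\<close> off \<open>K\<close>, so that \<open>|c| \<omega>(s)\<close> is
  small.

  Conversely, a dense vector is \<open>\<Sum>\<^sub>k c\<^sub>k\<inverse> T\<^bsub>-s\<^sub>k\<^esub> g\<^sub>k\<close>, where \<open>(g\<^sub>k)\<close> takes each value of a countable dense set of
  compactly supported functions infinitely often and \<open>(s\<^sub>k, c\<^sub>k)\<close> is chosen recursively from \<open>P(\<Lambda>)\<close>.
\<close>

section \<open>Compactness in topological groups\<close>

lemma compact_sum_group: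
  fixes A B :: "'a::topological_group_add set"
  assumes "compact A" "compact B"
  shows "compact ((\<lambda>(x, y). x + y) ` (A \<times> B))"
proof (intro compact_continuous_image compact_Times assms)
  show "continuous_on (A \<times> B) (\<lambda>(x, y). x + y)"
    unfolding case_prod_beta by (intro continuous_intros)
qed

lemma compact_uminus_group:
  fixes A :: "'a::topological_group_add set"
  assumes "compact A"
  shows "compact (uminus ` A)"
  by (intro compact_continuous_image assms continuous_intros)

text \<open>Baire category: the closed sublevel sets cover the group, so one of them contains a
  nonempty open set \<open>V\<close>. Finitely many translates of \<open>V\<close> cover
  \<open>K\<close>, and submultiplicativity carries the bound from \<open>V\<close> to each
  translate. Reading \<open>P s c\<close> as "\<open>c\<close> is an admissible constant for
  \<open>s\<close>" serves left and right quotients at once and avoids naming a least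
  constant.\<close>

lemma submultiplicative_locally_bounded:
  fixes P :: "'a::{topological_group_add, t2_space} \<Rightarrow> real \<Rightarrow> bool"
  assumes lc: "locally_compact_space (euclidean :: 'a topology)"
    and closed: "\<And>c. closed {s. P s c}"
    and mono: "\<And>s c d. P s c \<Longrightarrow> c \<le> d \<Longrightarrow> P s d"
    and ex: "\<And>s. \<exists>c. P s c"
    and add: "\<And>x y a b. P x a \<Longrightarrow> P y b \<Longrightarrow> 0 < a \<Longrightarrow> 0 < b \<Longrightarrow> P (x + y) (a * b)"
    and K: "compact K"
  shows "\<exists>C>0. \<forall>s\<in>K. P s C"
proof -
  \<comment> \<open>The levels start at 1 so that the bounds are positive, as \<open>add\<close>
    demands.\<close>
  let ?\<G> = "range (\<lambda>n::nat. {s. P s (real n + 1)})"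
  have "\<Union>?\<G> = UNIV"
  proof -
    have "\<exists>n::nat. P s (real n + 1)" for s
    proof -
      obtain c where "P s c" using ex by blast
      moreover have "c \<le> real (nat \<lceil>c\<rceil>) + 1" by linarith
      ultimately show ?thesis using mono by blast
    qed
    then show ?thesis by auto
  qed
  moreover have "regular_space (euclidean :: 'a topology)"
    by (intro locally_compact_Hausdorff_imp_regular_space lc)
      (simp add: Hausdorff_space_def disjnt_def separation_t2)
  then have "\<Union>?\<G> \<noteq> UNIV" if "\<And>T. T \<in> ?\<G> \<Longrightarrow> interior T = {}"
    using Baire_category_alt[of "euclidean :: 'a topology" ?\<G>] that lc closed by fastforce
  ultimately obtain n :: nat where "interior {s. P s (real n + 1)} \<noteq> {}" by blast
  then obtain V where V: "open V" "V \<noteq> {}" "V \<subseteq> {s. P s (real n + 1)}"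
    using open_interior interior_subset by metis
  then obtain v where v: "v \<in> V" by blast
  have op: "open ((\<lambda>x. - y + x) -` V)" for y
    by (intro open_vimage V continuous_intros)
  have "K \<subseteq> (\<Union>y\<in>UNIV. (\<lambda>x. - y + x) -` V)"
  proof
    fix x
    \<comment> \<open>Translating by \<open>x - v\<close> carries \<open>v\<close> to
      \<open>x\<close>.\<close>
    have "x \<in> (\<lambda>z. - (x - v) + z) -` V" using v by simp
    then show "x \<in> (\<Union>y\<in>UNIV. (\<lambda>x. - y + x) -` V)" by blast
  qed
  then obtain Y where Y: "finite Y" "K \<subseteq> (\<Union>y\<in>Y. (\<lambda>x. - y + x) -` V)"
    using compactE_image[OF K, of UNIV "\<lambda>y. (\<lambda>x. - y + x) -` V"] op by metis
  have "\<exists>c>0. P y c" for y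
  proof -
    obtain c where "P y c" using ex by blast
    then have "P y (max c 1)" using mono by simp
    then show ?thesis by (intro exI[of _ "max c 1"]) auto
  qed
  then obtain m where m: "\<And>y. m y > 0" "\<And>y. P y (m y)" by metis
  \<comment> \<open>The sum dominates each single \<open>m y\<close>; the summand 1 keeps
    \<open>C\<close> positive even when \<open>Y\<close> is empty.\<close>
  define C where "C = (1 + (\<Sum>y\<in>Y. m y)) * (real n + 1)"
  show ?thesis
  proof (intro exI conjI ballI)
    have s0: "0 \<le> (\<Sum>y\<in>Y. m y)" using m by (intro sum_nonneg) (simp add: less_imp_le)
    show "0 < C" unfolding C_def using s0 by (intro mult_pos_pos) auto
    fix s assume "s \<in> K"
    then obtain y where y: "y \<in> Y" "- y + s \<in> V" using Y by auto
    have "P (y + (- y + s)) (m y * (real n + 1))"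
      using m V(3) y by (intro add) auto
    moreover have "m y \<le> (\<Sum>y\<in>Y. m y)" using y Y m by (intro member_le_sum) (auto simp: less_imp_le)
    then have "m y * (real n + 1) \<le> C" unfolding C_def by (intro mult_right_mono) auto
    ultimately show "P s C" using mono by (simp add: add.assoc[symmetric])
  qed
qed

text \<open>The relatively compact open sets cover the space. Lindelof extracts a countable
  subcover, and finite unions of compact sets containing its members form the exhaustion.\<close>

lemma compact_exhaustion:
  assumes lc: "locally_compact_space (euclidean :: 'a topology)"
  obtains K :: "nat \<Rightarrow> 'a::second_countable_topology set"
  where "\<And>n. compact (K n)" "incseq K" "(\<Union>n. K n) = UNIV"
proof -
  let ?F = "{U :: 'a set. open U \<and> (\<exists>K. compact K \<and> U \<subseteq> K)}"
  obtain F' where F': "F' \<subseteq> ?F" "countable F'" "\<Union>F' = \<Union>?F"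
    using Lindelof[of ?F] by auto
  have "\<Union>?F = UNIV"
    using lc unfolding locally_compact_space_def by (auto simp: ) blast
  then have un: "\<Union>F' = UNIV" using F' by simp
  then have ne: "F' \<noteq> {}" by auto
  have "\<forall>U\<in>F'. \<exists>K. compact K \<and> U \<subseteq> K" using F' by auto
  then obtain k where k: "\<And>U. U \<in> F' \<Longrightarrow> compact (k U) \<and> U \<subseteq> k U" by metis
  define K where "K n = (\<Union>i\<le>n. k (from_nat_into F' i))" for n
  show ?thesis
  proof
    show "compact (K n)" for n
      unfolding K_def using k from_nat_into[OF ne] by (intro compact_UN) auto
    show "incseq K" unfolding K_def incseq_def using order_trans by blast
    show "(\<Union>n. K n) = UNIV"
    proof -
      have "x \<in> (\<Union>n. K n)" for x
      proof -
        obtain U where U: "U \<in> F'" "x \<in> U" using un by (metis UnionE UNIV_I)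
        obtain i where "from_nat_into F' i = U" using from_nat_into_surj[OF F'(2) U(1)] ..
        then have "x \<in> k (from_nat_into F' i)" using k U by auto
        then have "x \<in> K i" unfolding K_def by auto
        then show ?thesis by blast
      qed
      then show ?thesis by blast
    qed
  qed
qed

section \<open>Weighted integrals of translates\<close>

text \<open>Both norms are at most their maximum, which costs the factor \<open>2 powr p\<close>.
  This quasi-triangle inequality for \<open>p\<close>-th powers stands in for Minkowski in all later
  estimates of finite sums.\<close>

lemma norm_add_powr_le:
  fixes a b :: "'b::real_normed_vector"
  assumes "0 \<le> p"
  shows "norm (a + b) powr p \<le> 2 powr p * (norm a powr p + norm b powr p)"
proof -
  have "norm (a + b) powr p \<le> (2 * max (norm a) (norm b)) powr p"
    using norm_triangle_ineq[of a b] by (intro powr_mono2 assms) auto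
  also have "\<dots> = 2 powr p * max (norm a) (norm b) powr p"
    by (simp add: powr_mult)
  also have "max (norm a) (norm b) powr p \<le> norm a powr p + norm b powr p"
    by (auto simp: max_def)
  finally show ?thesis by simp
qed

text \<open>The weights \<open>2\<^sup>k\<^sup>p\<close> make a Minkowski inequality for infinite sums unnecessary.\<close>

lemma norm_suminf_powr_le:
  fixes x :: "nat \<Rightarrow> 'b::banach" and p :: real
  assumes p: "0 < p" and fin: "(\<Sum>k. ennreal (2 powr (k * p) * norm (x k) powr p)) < \<infinity>"
  shows "summable x"
    and "ennreal (norm (\<Sum>k. x k) powr p)
      \<le> ennreal (2 powr p) * (\<Sum>k. ennreal (2 powr (k * p) * norm (x k) powr p))"
proof -
  let ?y = "\<lambda>k::nat. 2 powr (k * p) * norm (x k) powr p"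
  have sy: "summable ?y" using fin by (intro summable_suminf_not_top) auto
  define T where "T = (\<Sum>k. ?y k)"
  have T0: "0 \<le> T" unfolding T_def by (intro suminf_nonneg sy) auto
  \<comment> \<open>A single term of the weighted series is at most its sum \<open>T\<close>, so the
    weights force geometric decay of \<open>norm (x k)\<close>.\<close>
  have b: "norm (x k) \<le> T powr (1 / p) * (1 / 2) ^ k" for k
  proof -
    have "?y k \<le> T" unfolding T_def using sum_le_suminf[OF sy, of "{k}"] by auto
    then have "(2 powr (k * p) * norm (x k) powr p) powr (1 / p) \<le> T powr (1 / p)"
      using p by (intro powr_mono2) auto
    moreover have "(2 powr (k * p) * norm (x k) powr p) powr (1 / p) = 2 ^ k * norm (x k)"
      using p by (simp add: powr_mult powr_powr powr_realpow)
    ultimately show ?thesis by (simp add: field_simps power_divide)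
  qed
  have sg: "summable (\<lambda>k. T powr (1 / p) * (1 / 2) ^ k)"
    by (intro summable_mult summable_geometric) auto
  show "summable x" using b by (intro summable_comparison_test'[OF sg]) auto
  have sn: "summable (\<lambda>k. norm (x k))" using b by (intro summable_comparison_test'[OF sg]) auto
  have "norm (\<Sum>k. x k) \<le> (\<Sum>k. norm (x k))" by (rule summable_norm[OF sn])
  also have "\<dots> \<le> (\<Sum>k. T powr (1 / p) * (1 / 2) ^ k)" by (intro suminf_le b sn sg)
  also have "\<dots> = 2 * T powr (1 / p)"
    by (subst suminf_mult) (auto simp: suminf_geometric intro!: summable_geometric)
  finally have "norm (\<Sum>k. x k) powr p \<le> (2 * T powr (1 / p)) powr p"
    using p by (intro powr_mono2) auto
  also have "\<dots> = 2 powr p * T" using p T0 by (simp add: powr_mult powr_powr)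
  finally have "ennreal (norm (\<Sum>k. x k) powr p) \<le> ennreal (2 powr p) * ennreal T"
    by (auto simp: ennreal_mult'[symmetric] intro: ennreal_leI)
  also have "ennreal T = (\<Sum>k. ennreal (?y k))"
    unfolding T_def by (intro suminf_ennreal_eq[symmetric] summable_sums sy) auto
  finally show "ennreal (norm (\<Sum>k. x k) powr p) \<le> ennreal (2 powr p) * (\<Sum>k. ennreal (?y k))" .
qed

text \<open>Finiteness of the two suprema is recorded as pointwise inequalities with real constants,
  so that estimates of the weight stay in the reals.\<close>

locale weighted_group =
  fixes \<mu> :: "'a :: {topological_group_add, t2_space, second_countable_topology} measure"
    and p :: real and \<omega> :: "'a \<Rightarrow> real"
  assumes lc: "locally_compact_space (euclidean :: 'a topology)"
    and haar: "left_haar_measure \<mu>"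
    and p1: "1 \<le> p"
    and pos: "\<And>t. 0 < \<omega> t"
    and cont: "continuous_on UNIV \<omega>"
    and left_quot: "\<And>s. \<exists>C. \<forall>t. \<omega> (s + t) \<le> C * \<omega> t"
    and right_quot: "\<And>s. \<exists>C. \<forall>t. \<omega> (t + s) \<le> C * \<omega> t"
begin

lemma sets_eq [measurable_cong]: "sets \<mu> = sets borel"
  using haar by (simp add: left_haar_measure_def)

lemma space_eq [simp]: "space \<mu> = UNIV"
  using sets_eq_imp_space_eq[OF sets_eq] by simp

lemma p0: "0 < p" using p1 by simp

lemma cont_comp [continuous_intros]: "continuous_on A f \<Longrightarrow> continuous_on A (\<lambda>x. \<omega> (f x))"
  using continuous_on_compose2[OF cont] by blast

section \<open>Translation quotients of the weight, bounded uniformly on compact sets\<close>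

lemma closed_le_quot:
  "closed {s. \<forall>t. \<omega> (s + t) \<le> c * \<omega> t}" "closed {s. \<forall>t. \<omega> (t + s) \<le> c * \<omega> t}"
  by (intro closed_Collect_all closed_Collect_le continuous_intros)+

lemma left_bound:
  assumes "compact K"
  obtains C where "0 < C" "\<And>s t. s \<in> K \<Longrightarrow> \<omega> (s + t) \<le> C * \<omega> t"
proof -
  have "\<exists>C>0. \<forall>s\<in>K. \<forall>t. \<omega> (s + t) \<le> C * \<omega> t"
  proof (rule submultiplicative_locally_bounded[where P = "\<lambda>s c. \<forall>t. \<omega> (s + t) \<le> c * \<omega> t"])
    fix x y :: 'a and a b :: real
    assume x: "\<forall>t. \<omega> (x + t) \<le> a * \<omega> t" and y: "\<forall>t. \<omega> (y + t) \<le> b * \<omega> t" and "0 < a"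
    show "\<forall>t. \<omega> (x + y + t) \<le> a * b * \<omega> t"
    proof
      fix t
      have "\<omega> (x + (y + t)) \<le> a * \<omega> (y + t)" using x by blast
      also have "\<dots> \<le> a * (b * \<omega> t)" using y \<open>0 < a\<close> by simp
      finally show "\<omega> (x + y + t) \<le> a * b * \<omega> t" by (simp add: add.assoc mult.assoc)
    qed
  next
    fix s c d assume "\<forall>t. \<omega> (s + t) \<le> c * \<omega> t" "c \<le> (d::real)"
    then show "\<forall>t. \<omega> (s + t) \<le> d * \<omega> t"
      using pos mult_right_mono[of c d] by (meson less_imp_le order_trans)
  qed (use lc assms left_quot closed_le_quot in auto)
  then show ?thesis using that by blast
qed

lemma right_bound:
  assumes "compact K"
  obtains C where "0 < C" "\<And>s t. s \<in> K \<Longrightarrow> \<omega> (t + s) \<le> C * \<omega> t"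
proof -
  have "\<exists>C>0. \<forall>s\<in>K. \<forall>t. \<omega> (t + s) \<le> C * \<omega> t"
  proof (rule submultiplicative_locally_bounded[where P = "\<lambda>s c. \<forall>t. \<omega> (t + s) \<le> c * \<omega> t"])
    fix x y :: 'a and a b :: real
    assume x: "\<forall>t. \<omega> (t + x) \<le> a * \<omega> t" and y: "\<forall>t. \<omega> (t + y) \<le> b * \<omega> t" and "0 < b"
    show "\<forall>t. \<omega> (t + (x + y)) \<le> a * b * \<omega> t"
    proof
      fix t
      have "\<omega> ((t + x) + y) \<le> b * \<omega> (t + x)" using y by blast
      also have "\<dots> \<le> b * (a * \<omega> t)" using x \<open>0 < b\<close> by simp
      finally show "\<omega> (t + (x + y)) \<le> a * b * \<omega> t" by (simp add: add.assoc mult_ac)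
    qed
  next
    fix s c d assume "\<forall>t. \<omega> (t + s) \<le> c * \<omega> t" "c \<le> (d::real)"
    then show "\<forall>t. \<omega> (t + s) \<le> d * \<omega> t"
      using pos mult_right_mono[of c d] by (meson less_imp_le order_trans)
  qed (use lc assms right_quot closed_le_quot in auto)
  then show ?thesis using that by blast
qed

text \<open>The upper bound over the inverses of \<open>K\<close>, which again form a compact set,
  is applied at the point \<open>t + s\<close>.\<close>

lemma right_bound_lower:
  assumes "compact K"
  obtains C where "0 < C" "\<And>s t. s \<in> K \<Longrightarrow> \<omega> t \<le> C * \<omega> (t + s)"
proof -
  obtain C where C: "0 < C" "\<And>s t. s \<in> uminus ` K \<Longrightarrow> \<omega> (t + s) \<le> C * \<omega> t"
    using right_bound[OF compact_uminus_group[OF assms]] by blast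
  show ?thesis
  proof
    fix s t assume "s \<in> K"
    then have "\<omega> ((t + s) + - s) \<le> C * \<omega> (t + s)" using C by blast
    then show "\<omega> t \<le> C * \<omega> (t + s)" by (simp add: add.assoc)
  qed fact
qed

lemma left_bound_lower:
  assumes "compact K"
  obtains C where "0 < C" "\<And>s t. s \<in> K \<Longrightarrow> \<omega> t \<le> C * \<omega> (s + t)"
proof -
  obtain C where C: "0 < C" "\<And>s t. s \<in> uminus ` K \<Longrightarrow> \<omega> (s + t) \<le> C * \<omega> t"
    using left_bound[OF compact_uminus_group[OF assms]] by blast
  show ?thesis
  proof
    fix s t assume "s \<in> K"
    then have "\<omega> (- s + (s + t)) \<le> C * \<omega> (s + t)" using C by blast
    then show "\<omega> t \<le> C * \<omega> (s + t)" by (simp add: add.assoc[symmetric])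
  qed fact
qed

section \<open>Measurability and left invariance\<close>

lemma measurable_weight [measurable]: "\<omega> \<in> borel_measurable borel"
  by (intro borel_measurable_continuous_onI cont)

lemma measurable_translate [measurable]: "(\<lambda>t::'a. s + t) \<in> measurable borel borel"
proof (rule borel_measurable_continuous_onI)
  show "continuous_on UNIV (\<lambda>t::'a. s + t)"
    by (rule continuous_on_add[OF continuous_on_const continuous_on_id])
qed

lemma sets_compact [measurable]: "compact K \<Longrightarrow> K \<in> sets borel" for K :: "'a set"
  by (intro borel_closed compact_imp_closed)

lemma emeasure_compact: "compact K \<Longrightarrow> emeasure \<mu> K < \<infinity>"
  using haar unfolding left_haar_measure_def by blast

lemma translate_image: "(+) s ` A = (\<lambda>t. - s + t) -` A" for s :: 'a
proof
  show "(\<lambda>t. - s + t) -` A \<subseteq> (+) s ` A"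
  proof
    fix x assume "x \<in> (\<lambda>t. - s + t) -` A"
    then have "x = s + (- s + x)" "- s + x \<in> A" by (simp_all add: add.assoc[symmetric])
    then show "x \<in> (+) s ` A" by blast
  qed
qed (auto simp: add.assoc[symmetric])

lemma emeasure_translate: "A \<in> sets borel \<Longrightarrow> emeasure \<mu> ((+) s ` A) = emeasure \<mu> A"
  using haar unfolding left_haar_measure_def by blast

text \<open>Invariance as a push-forward identity, the form from which integrals can be
  translated.\<close>

lemma distr_translate: "distr \<mu> \<mu> (\<lambda>t. s + t) = \<mu>"
proof (rule measure_eqI)
  fix A assume "A \<in> sets (distr \<mu> \<mu> (\<lambda>t. s + t))"
  then have A: "A \<in> sets borel" "A \<in> sets \<mu>" using sets_eq by auto
  have "emeasure (distr \<mu> \<mu> (\<lambda>t. s + t)) A = emeasure \<mu> ((\<lambda>t. - (- s) + t) -` A)"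
    using A by (subst emeasure_distr) auto
  also have "\<dots> = emeasure \<mu> A"
    unfolding translate_image[symmetric] by (rule emeasure_translate) fact
  finally show "emeasure (distr \<mu> \<mu> (\<lambda>t. s + t)) A = emeasure \<mu> A" .
qed simp

lemma nn_integral_translate:
  assumes [measurable]: "h \<in> borel_measurable borel"
  shows "(\<integral>\<^sup>+t. h (s + t) \<partial>\<mu>) = (\<integral>\<^sup>+t. h t \<partial>\<mu>)"
  by (subst (2) distr_translate[of s, symmetric], subst nn_integral_distr) auto

text \<open>
  Up to \<open>p\<close>-th powers, \<open>wint E s u\<close> is the weighted norm of \<open>T\<^sub>s u\<close> restricted to \<open>s + E\<close>. Measuring translates
  in the coordinates of the untranslated function avoids translating null sets and sets of summability.
\<close>

definition wint :: "'a set \<Rightarrow> 'a \<Rightarrow> ('a \<Rightarrow> complex) \<Rightarrow> ennreal" where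
  "wint E s u = (\<integral>\<^sup>+t\<in>E. ennreal (norm (u t) powr p * \<omega> (s + t) powr p) \<partial>\<mu>)"

section \<open>Calculus of the weighted integrals \<open>wint\<close>\<close>

lemma wint_le:
  assumes "\<And>t. t \<in> E \<Longrightarrow> norm (u t) powr p * \<omega> (s + t) powr p
    \<le> c * (norm (v t) powr p * \<omega> (s' + t) powr p)"
    and "0 \<le> c" and [measurable]: "E \<in> sets borel" "v \<in> borel_measurable borel"
  shows "wint E s u \<le> ennreal c * wint E s' v"
proof -
  have "wint E s u \<le> (\<integral>\<^sup>+t. ennreal c
    * (ennreal (norm (v t) powr p * \<omega> (s' + t) powr p) * indicator E t) \<partial>\<mu>)"
    unfolding wint_def using assms
    by (intro nn_integral_mono) (auto simp: indicator_def ennreal_mult'[symmetric] intro!: ennreal_leI)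
  also have "\<dots> = ennreal c * wint E s' v"
    unfolding wint_def by (rule nn_integral_cmult) measurable
  finally show ?thesis .
qed

lemma wint_cmult:
  assumes [measurable]: "E \<in> sets borel" "u \<in> borel_measurable borel"
  shows "wint E s (\<lambda>t. c * u t) = ennreal (norm c powr p) * wint E s u"
proof -
  have "wint E s (\<lambda>t. c * u t) =
    (\<integral>\<^sup>+t. ennreal (norm c powr p) * (ennreal (norm (u t) powr p * \<omega> (s + t) powr p) * indicator E t)
    \<partial>\<mu>)"
    unfolding wint_def
    by (intro nn_integral_cong)
      (auto simp: indicator_def ennreal_mult'[symmetric] norm_mult powr_mult mult_ac)
  also have "\<dots> = ennreal (norm c powr p) * wint E s u"
    unfolding wint_def by (rule nn_integral_cmult) measurable
  finally show ?thesis .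
qed

lemma wint_add:
  assumes [measurable]: "E \<in> sets borel" "u \<in> borel_measurable borel" "v \<in> borel_measurable borel"
  shows "wint E s (\<lambda>t. u t + v t) \<le> ennreal (2 powr p) * (wint E s u + wint E s v)"
proof -
  have "wint E s (\<lambda>t. u t + v t) \<le> (\<integral>\<^sup>+t. ennreal (2 powr p) *
     (ennreal (norm (u t) powr p * \<omega> (s + t) powr p) * indicator E t + ennreal
     (norm (v t) powr p * \<omega> (s + t) powr p) * indicator E t) \<partial>\<mu>)"
    unfolding wint_def
  proof (rule nn_integral_mono)
    fix t
    have "norm (u t + v t) powr p * \<omega> (s + t) powr p
      \<le> 2 powr p * (norm (u t) powr p + norm (v t) powr p) * \<omega> (s + t) powr p"
      using p0 by (intro mult_right_mono norm_add_powr_le) auto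
    then show "ennreal (norm (u t + v t) powr p * \<omega> (s + t) powr p) * indicator E t
      \<le> ennreal (2 powr p) *
     (ennreal (norm (u t) powr p * \<omega> (s + t) powr p) * indicator E t + ennreal
     (norm (v t) powr p * \<omega> (s + t) powr p) * indicator E t)"
      by (auto simp: indicator_def ennreal_mult'[symmetric] ennreal_plus[symmetric]
        algebra_simps simp del: ennreal_plus intro!: ennreal_leI)
  qed
  also have "\<dots> = ennreal (2 powr p) * (wint E s u + wint E s v)"
    unfolding wint_def by (subst nn_integral_cmult, measurable, subst nn_integral_add) auto
  finally show ?thesis .
qed

lemma wint_diff_triangle:
  assumes [measurable]: "E \<in> sets borel" "u \<in> borel_measurable borel" "v \<in> borel_measurable borel"
    "w \<in> borel_measurable borel"
  shows "wint E s (\<lambda>t. u t - w t)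
    \<le> ennreal (2 powr p) * (wint E s (\<lambda>t. u t - v t) + wint E s (\<lambda>t. v t - w t))"
  using wint_add[of E "\<lambda>t. u t - v t" "\<lambda>t. v t - w t" s] by simp

lemma wint_swap: "wint E s (\<lambda>t. u t - v t) = wint E s (\<lambda>t. v t - u t)"
  unfolding wint_def by (simp add: norm_minus_commute)

lemma wint_mono_set: "E \<subseteq> F \<Longrightarrow> wint E s u \<le> wint F s u"
  unfolding wint_def by (intro nn_integral_mono mult_left_mono) (auto simp: indicator_def)

lemma wint_split:
  assumes [measurable]: "E \<in> sets borel" "u \<in> borel_measurable borel"
  shows "wint UNIV s u = wint E s u + wint (- E) s u"
proof -
  have "wint UNIV s u = (\<integral>\<^sup>+t. ennreal (norm (u t) powr p * \<omega> (s + t) powr p) * indicator E t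
    + ennreal (norm (u t) powr p * \<omega> (s + t) powr p) * indicator (- E) t \<partial>\<mu>)"
    unfolding wint_def by (intro nn_integral_cong) (auto simp: indicator_def)
  also have "\<dots> = wint E s u + wint (- E) s u"
    unfolding wint_def by (rule nn_integral_add) auto
  finally show ?thesis .
qed

text \<open>Left invariance of the measure permits the substitution of \<open>s + t\<close> for
  \<open>t\<close>. It trades a translated function at base point 0 for the untranslated one at base
  point \<open>s\<close>.\<close>

lemma wint_translate:
  assumes [measurable]: "E \<in> sets borel" "u \<in> borel_measurable borel"
  shows "wint E 0 u = wint ((\<lambda>t. s + t) -` E) s (\<lambda>t. u (s + t))"
proof -
  have "wint E 0 u = (\<integral>\<^sup>+t. ennreal (norm (u t) powr p * \<omega> t powr p) * indicator E t \<partial>\<mu>)"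
    by (simp add: wint_def)
  also have "\<dots> = (\<integral>\<^sup>+t. ennreal (norm (u (s + t)) powr p * \<omega> (s + t) powr p) * indicator E (s + t) \<partial>\<mu>)"
    by (rule nn_integral_translate[symmetric]) measurable
  finally show ?thesis by (simp add: wint_def indicator_def)
qed

text \<open>Dominated convergence: each point lies in all \<open>K n\<close> from some index on, so
  the integrand over the complements is eventually 0 there.\<close>

lemma wint_exhaust:
  assumes K: "\<And>n. K n \<in> sets borel" "incseq K" "(\<Union>n. K n) = UNIV"
    and u [measurable]: "u \<in> borel_measurable borel" and fin: "wint UNIV s u < \<infinity>"
  shows "(\<lambda>n. wint (- K n) s u) \<longlonglongrightarrow> 0"
proof -
  note K(1)[measurable]
  have "(\<lambda>n. wint (- K n) s u) \<longlonglongrightarrow> (\<integral>\<^sup>+t. 0 \<partial>\<mu>)"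
    unfolding wint_def
  proof (rule nn_integral_dominated_convergence[where w =
    "\<lambda>t. ennreal (norm (u t) powr p * \<omega> (s + t) powr p)"])
    show "AE t in \<mu>. (\<lambda>n. ennreal (norm (u t) powr p * \<omega> (s + t) powr p) * indicator (- K n) t) \<longlonglongrightarrow> 0"
    proof (rule AE_I2)
      fix t
      obtain N where "t \<in> K N" using K(3) by blast
      then have "t \<in> K n" if "n \<ge> N" for n using that K(2) unfolding incseq_def by blast
      then have "eventually (\<lambda>n. ennreal (norm (u t) powr p * \<omega> (s + t) powr p) * indicator (- K n) t
        = 0) sequentially"
        unfolding eventually_sequentially by (intro exI[of _ N]) auto
      then show "(\<lambda>n. ennreal (norm (u t) powr p * \<omega> (s + t) powr p) * indicator (- K n) t) \<longlonglongrightarrow> 0"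
        by (rule tendsto_eventually)
    qed
  qed (use fin in \<open>auto simp: wint_def indicator_def\<close>)
  then show ?thesis by simp
qed

lemma wint_tail:
  assumes u: "u \<in> borel_measurable borel" "wint UNIV s u < \<infinity>" and d: "0 < \<delta>"
  obtains L where "compact L" "wint (- L) s u < \<delta>"
proof -
  obtain K :: "nat \<Rightarrow> 'a set" where K: "\<And>n. compact (K n)" "incseq K" "(\<Union>n. K n) = UNIV"
    using compact_exhaustion[OF lc] by blast
  have "(\<lambda>n. wint (- K n) s u) \<longlonglongrightarrow> 0"
    using K sets_compact by (intro wint_exhaust u) auto
  then have "eventually (\<lambda>n. wint (- K n) s u < \<delta>) sequentially"
    using d by (rule order_tendstoD)
  then show ?thesis using that K(1) unfolding eventually_sequentially by blast
qed

section \<open>Seminorm and density expressed by \<open>wint\<close>\<close>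

lemma measurable_mu: "f \<in> borel_measurable \<mu> \<longleftrightarrow> f \<in> borel_measurable borel"
  using measurable_cong_sets[OF sets_eq refl] by blast

lemma weighted_Lp_iff: "f \<in> weighted_Lp \<mu> p \<omega> \<longleftrightarrow> f \<in> borel_measurable borel \<and> wint UNIV 0 f < \<infinity>"
  unfolding weighted_Lp_def wint_def by (simp add: measurable_mu)

lemma weighted_Lp_diff:
  assumes "f \<in> weighted_Lp \<mu> p \<omega>" "g \<in> weighted_Lp \<mu> p \<omega>"
  shows "wint UNIV 0 (\<lambda>t. f t - g t) < \<infinity>"
proof -
  have "wint UNIV 0 (\<lambda>t. f t - g t)
    \<le> ennreal (2 powr p) * (wint UNIV 0 (\<lambda>t. f t - 0) + wint UNIV 0 (\<lambda>t. 0 - g t))"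
    using assms by (intro wint_diff_triangle) (auto simp: weighted_Lp_iff)
  also have "\<dots> < \<infinity>"
    using assms wint_swap[of UNIV 0 "\<lambda>t. 0" g] by (auto simp: weighted_Lp_iff ennreal_mult_less_top)
  finally show ?thesis .
qed

text \<open>Finiteness matters because \<open>enn2real\<close> sends infinity to 0: a function with
  infinite integral would otherwise count as having seminorm 0.\<close>

lemma weighted_Lp_norm_less_iff:
  assumes "wint UNIV 0 u < \<infinity>" "0 < \<epsilon>"
  shows "weighted_Lp_norm \<mu> p \<omega> u < \<epsilon> \<longleftrightarrow> wint UNIV 0 u < ennreal (\<epsilon> powr p)"
proof -
  define r where "r = enn2real (wint UNIV 0 u)"
  have r: "wint UNIV 0 u = ennreal r" "0 \<le> r" using assms by (auto simp: r_def)
  have "weighted_Lp_norm \<mu> p \<omega> u = r powr (1 / p)"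
    unfolding weighted_Lp_norm_def r_def wint_def by simp
  moreover have "r powr (1 / p) < \<epsilon> \<longleftrightarrow> r < \<epsilon> powr p"
  proof
    assume "r powr (1 / p) < \<epsilon>"
    then have "(r powr (1 / p)) powr p < \<epsilon> powr p" using p0 by (intro powr_less_mono2) auto
    then show "r < \<epsilon> powr p" using p0 r by (simp add: powr_powr)
  next
    assume "r < \<epsilon> powr p"
    then have "r powr (1 / p) < (\<epsilon> powr p) powr (1 / p)" using p0 r by (intro powr_less_mono2) auto
    then show "r powr (1 / p) < \<epsilon>" using p0 assms by (simp add: powr_powr)
  qed
  ultimately show ?thesis using r by (simp add: ennreal_less_iff)
qed

text \<open>Since \<epsilon> is arbitrary, the \<open>p\<close>-th root can be absorbed into it. The
  inclusion of \<open>D\<close> in the space keeps all differences finite, so that the seminorm is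
  meaningful on them.\<close>

lemma dense_in_weighted_Lp_iff:
  "dense_in_weighted_Lp \<mu> p \<omega> D \<longleftrightarrow> D \<subseteq> weighted_Lp \<mu> p \<omega> \<and>
    (\<forall>g\<in>weighted_Lp \<mu> p \<omega>. \<forall>\<epsilon>>0. \<exists>h\<in>D. wint UNIV 0 (\<lambda>t. h t - g t) < ennreal \<epsilon>)"
  (is "_ \<longleftrightarrow> _ \<and> ?R")
proof (cases "D \<subseteq> weighted_Lp \<mu> p \<omega>")
  case True
  then have *: "weighted_Lp_norm \<mu> p \<omega> (\<lambda>t. h t - g t) < \<epsilon> \<longleftrightarrow> wint UNIV 0 (\<lambda>t. h t - g t)
    < ennreal (\<epsilon> powr p)"
    if "h \<in> D" "g \<in> weighted_Lp \<mu> p \<omega>" "0 < \<epsilon>" for h g \<epsilon>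
    using that by (intro weighted_Lp_norm_less_iff weighted_Lp_diff) auto
  have pp: "(\<epsilon> powr (1 / p)) powr p = \<epsilon>" if "0 < \<epsilon>" for \<epsilon> using that p0 by (simp add: powr_powr)
  show ?thesis
  proof
    assume d: "dense_in_weighted_Lp \<mu> p \<omega> D"
    have ?R
    proof (intro ballI allI impI)
      fix g \<epsilon> assume g: "g \<in> weighted_Lp \<mu> p \<omega>" and e: "0 < (\<epsilon>::real)"
      then have "0 < \<epsilon> powr (1 / p)" by simp
      then show "\<exists>h\<in>D. wint UNIV 0 (\<lambda>t. h t - g t) < ennreal \<epsilon>"
        using d * g pp[OF e] unfolding dense_in_weighted_Lp_def by metis
    qed
    then show "D \<subseteq> weighted_Lp \<mu> p \<omega> \<and> ?R" using True by blast
  next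
    assume r: "D \<subseteq> weighted_Lp \<mu> p \<omega> \<and> ?R"
    show "dense_in_weighted_Lp \<mu> p \<omega> D"
      unfolding dense_in_weighted_Lp_def
    proof (intro conjI ballI allI impI True)
      fix g \<epsilon> assume g: "g \<in> weighted_Lp \<mu> p \<omega>" and e: "0 < (\<epsilon>::real)"
      then have "0 < \<epsilon> powr p" by simp
      then show "\<exists>h\<in>D. weighted_Lp_norm \<mu> p \<omega> (\<lambda>t. h t - g t) < \<epsilon>"
        using r * g e by blast
    qed
  qed
qed (simp add: dense_in_weighted_Lp_def)

text \<open>Boundedness of left translation by \<open>s\<close>, read at \<open>p\<close>-th powers:
  only the base point changes, so the comparison is one of weights.\<close>

lemma wint_left_le:
  assumes C: "0 < C" "\<And>t. \<omega> (s + t) \<le> C * \<omega> t"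
    and [measurable]: "E \<in> sets borel" "u \<in> borel_measurable borel"
  shows "wint E s u \<le> ennreal (C powr p) * wint E 0 u"
proof (rule wint_le)
  fix t
  have "\<omega> (s + t) powr p \<le> (C * \<omega> t) powr p" using C pos p0
    by (intro powr_mono2) (auto intro: less_imp_le)
  then have "norm (u t) powr p * \<omega> (s + t) powr p \<le> norm (u t) powr p * (C powr p * \<omega> t powr p)"
    by (intro mult_left_mono) (simp_all add: powr_mult)
  then show "norm (u t) powr p * \<omega> (s + t) powr p \<le> C powr p * (norm (u t) powr p * \<omega> (0 + t) powr p)"
    by (simp add: mult_ac)
qed auto

lemma wint_left_ge:
  assumes C: "0 < C" "\<And>t. \<omega> t \<le> C * \<omega> (s + t)"
    and [measurable]: "E \<in> sets borel" "u \<in> borel_measurable borel"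
  shows "wint E 0 u \<le> ennreal (C powr p) * wint E s u"
proof (rule wint_le)
  fix t
  have "\<omega> t powr p \<le> (C * \<omega> (s + t)) powr p" using C pos p0
    by (intro powr_mono2) (auto intro: less_imp_le)
  then have "norm (u t) powr p * \<omega> t powr p \<le> norm (u t) powr p * (C powr p * \<omega> (s + t) powr p)"
    by (intro mult_left_mono) (simp_all add: powr_mult)
  then show "norm (u t) powr p * \<omega> (0 + t) powr p \<le> C powr p * (norm (u t) powr p * \<omega> (s + t) powr p)"
    by (simp add: mult_ac)
qed auto

section \<open>Necessity of the condition on the weight\<close>

text \<open>With \<open>L\<close> compact carrying most of \<open>f\<close>, the set
  \<open>W = Q + L\<close> contains every \<open>s + L\<close> with \<open>s\<close> in
  \<open>Q\<close>; the bounds on left quotients over \<open>Q\<close> then compare both sides with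
  base point 0. The tail is bounded relative to the mass on \<open>W\<close> because such an
  inequality survives multiplication of \<open>f\<close> by an arbitrary scalar, and the scalars in
  \<open>\<Lambda>\<close> may be unbounded.\<close>

lemma translates_uniform_tail:
  assumes f [measurable]: "f \<in> borel_measurable borel" and fin: "wint UNIV 0 f < \<infinity>"
    and Q: "compact Q" and \<theta>: "0 < (\<theta>::real)"
  obtains W where "compact W"
    "\<And>s. s \<in> Q \<Longrightarrow> wint (- ((\<lambda>t. s + t) -` W)) s f \<le> ennreal \<theta> * wint ((\<lambda>t. s + t) -` W) s f"
proof -
  obtain C where C: "0 < C" "\<And>s t. s \<in> Q \<Longrightarrow> \<omega> (s + t) \<le> C * \<omega> t"
    using left_bound[OF Q] by blast
  obtain C' where C': "0 < C'" "\<And>s t. s \<in> Q \<Longrightarrow> \<omega> t \<le> C' * \<omega> (s + t)"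
    using left_bound_lower[OF Q] by blast
  define a where "a = enn2real (wint UNIV 0 f)"
  have a: "wint UNIV 0 f = ennreal a" "0 \<le> a" using fin by (auto simp: a_def)
  show ?thesis
  proof (cases "a = 0")
    case True
    show ?thesis
    proof (rule that[of "{}"])
      fix s assume "s \<in> Q"
      then have "wint UNIV s f \<le> ennreal (C powr p) * wint UNIV 0 f" by (intro wint_left_le C) auto
      then show "wint (- ((\<lambda>t. s + t) -` {})) s f \<le> ennreal \<theta> * wint ((\<lambda>t. s + t) -` {}) s f"
        using a True by simp
    qed simp
  next
    case False
    \<comment> \<open>The first bound leaves at least half of the mass \<open>a\<close> on
      \<open>L\<close>; the second yields the ratio \<open>\<theta>\<close> after the losses
      \<open>C powr p\<close> on the tail and \<open>C' powr p\<close> on the main part.\<close>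
    define \<delta> where "\<delta> = min (a / 2) (\<theta> * a / (2 * C powr p * C' powr p))"
    have \<delta>: "0 < \<delta>" using False a \<theta> C(1) C'(1) by (simp add: \<delta>_def)
    obtain L where L: "compact L" "wint (- L) 0 f < ennreal \<delta>"
      using wint_tail[OF f fin, of "ennreal \<delta>"] \<delta> by auto
    note sets_compact[OF L(1), measurable]
    have "ennreal a = wint L 0 f + wint (- L) 0 f"
      using wint_split[of L f 0] a by simp
    moreover obtain l' where l': "wint (- L) 0 f = ennreal l'" "0 \<le> l'" "l' < \<delta>"
      using L(2) by (metis enn2real_nonneg ennreal_enn2real ennreal_less_iff ennreal_less_top
        order_less_trans top_neq_ennreal)
    moreover obtain l where l: "wint L 0 f = ennreal l" "0 \<le> l"
      using fin wint_mono_set[of L UNIV 0 f]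
        by (metis ennreal_cases infinity_ennreal_def leD subset_UNIV)
    ultimately have "a = l + l'"
      using a by (simp add: ennreal_plus[symmetric] del: ennreal_plus)
    then have la: "a / 2 \<le> l" using l' unfolding \<delta>_def by linarith
    show ?thesis
    proof (rule that)
      show "compact ((\<lambda>(x, y). x + y) ` (Q \<times> L))" (is "compact ?W") by (intro compact_sum_group Q L)
      fix s assume s: "s \<in> Q"
      have sub: "L \<subseteq> (\<lambda>t. s + t) -` ?W" using s by auto
      have "wint (- ((\<lambda>t. s + t) -` ?W)) s f \<le> wint (- L) s f" using sub by (intro wint_mono_set) auto
      also have "\<dots> \<le> ennreal (C powr p) * wint (- L) 0 f" using s by (intro wint_left_le C) auto
      also have "\<dots> \<le> ennreal (C powr p * \<delta>)"
        using l' by (auto simp: ennreal_mult'[symmetric] intro!: ennreal_leI mult_left_mono)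
      finally have 1: "wint (- ((\<lambda>t. s + t) -` ?W)) s f \<le> ennreal (C powr p * \<delta>)" .
      have "ennreal (a / 2) \<le> wint L 0 f" using la l by (simp add: ennreal_leI)
      also have "\<dots> \<le> ennreal (C' powr p) * wint L s f" using s by (intro wint_left_ge C') auto
      also have "\<dots> \<le> ennreal (C' powr p) * wint ((\<lambda>t. s + t) -` ?W) s f"
        using sub by (intro mult_left_mono wint_mono_set) auto
      finally have 2: "ennreal (a / 2) \<le> ennreal (C' powr p) * wint ((\<lambda>t. s + t) -` ?W) s f" .
      have "C powr p * \<delta> \<le> C powr p * (\<theta> * a / (2 * C powr p * C' powr p))"
        unfolding \<delta>_def by (intro mult_left_mono) auto
      also have "\<dots> = \<theta> / C' powr p * (a / 2)" using C(1) by (simp add: field_simps)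
      finally have "C powr p * \<delta> \<le> \<theta> / C' powr p * (a / 2)" .
      then have "ennreal (C powr p * \<delta>) \<le> ennreal (\<theta> / C' powr p) * ennreal (a / 2)"
        using \<theta> by (simp add: ennreal_mult'[symmetric] ennreal_leI)
      also have "\<dots> \<le> ennreal (\<theta> / C' powr p) * (ennreal (C' powr p) * wint ((\<lambda>t. s + t) -` ?W) s f)"
        by (intro mult_left_mono 2) auto
      also have "\<dots> = ennreal \<theta> * wint ((\<lambda>t. s + t) -` ?W) s f"
        using \<theta> C'(1) by (simp add: mult.assoc[symmetric] ennreal_mult'[symmetric])
      finally show "wint (- ((\<lambda>t. s + t) -` ?W)) s f \<le> ennreal \<theta> * wint ((\<lambda>t. s + t) -` ?W) s f"
        using 1 by order
    qed
  qed
qed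

section \<open>Constant functions on compact sets as test functions\<close>

lemma wint_cong: "(\<And>t. t \<in> E \<Longrightarrow> u t = v t) \<Longrightarrow> wint E s u = wint E s v"
  unfolding wint_def by (intro nn_integral_cong) (auto simp: indicator_def)

lemma wint_restrict:
  "F \<subseteq> E \<Longrightarrow> (\<And>t. t \<in> E - F \<Longrightarrow> u t = 0) \<Longrightarrow> wint E s u = wint F s u"
  unfolding wint_def by (intro nn_integral_cong) (auto simp: indicator_def)

lemma weight_le_on_compact:
  assumes "compact K"
  obtains B where "0 < B" "\<And>t. t \<in> K \<Longrightarrow> \<omega> t \<le> B"
proof -
  obtain C where C: "0 < C" "\<And>s t. s \<in> K \<Longrightarrow> \<omega> (t + s) \<le> C * \<omega> t" using right_bound[OF assms] by blast
  show ?thesis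
  proof
    show "0 < C * \<omega> 0" using C pos by simp
    show "\<omega> t \<le> C * \<omega> 0" if "t \<in> K" for t using C(2)[OF that, of 0] by simp
  qed
qed

lemma wint_const_le_emeasure:
  assumes E: "E \<in> sets borel" and B: "\<And>t. t \<in> E \<Longrightarrow> \<omega> t \<le> B"
  shows "wint E 0 (\<lambda>_. c) \<le> ennreal (norm c powr p * B powr p) * emeasure \<mu> E"
proof -
  have "wint E 0 (\<lambda>_. c) \<le> (\<integral>\<^sup>+t. ennreal (norm c powr p * B powr p) * indicator E t \<partial>\<mu>)"
    unfolding wint_def using B p0
    by (intro nn_integral_mono)
      (auto simp: indicator_def less_imp_le[OF pos] intro!: ennreal_leI mult_left_mono powr_mono2)
  also have "\<dots> = ennreal (norm c powr p * B powr p) * emeasure \<mu> E"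
    using E by (intro nn_integral_cmult_indicator) (simp add: sets_eq)
  finally show ?thesis .
qed

lemma wint_const_finite:
  assumes K: "compact K"
  shows "wint K 0 (\<lambda>_. c) < \<infinity>"
proof -
  obtain B where B: "\<And>t. t \<in> K \<Longrightarrow> \<omega> t \<le> B" using weight_le_on_compact[OF K] by blast
  have "wint K 0 (\<lambda>_. c) \<le> ennreal (norm c powr p * B powr p) * emeasure \<mu> K"
    using sets_compact[OF K] B by (rule wint_const_le_emeasure)
  also have "\<dots> < \<infinity>" using emeasure_compact[OF K] by (simp add: ennreal_mult_less_top)
  finally show ?thesis .
qed

lemma wint_one_pos:
  assumes K: "K \<in> sets borel" "0 < emeasure \<mu> K"
  shows "0 < wint K 0 (\<lambda>_. 1)"
proof (rule ccontr)
  note K(1) [measurable]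
  assume "\<not> ?thesis"
  then have "(\<integral>\<^sup>+t. ennreal (\<omega> t powr p) * indicator K t \<partial>\<mu>) = 0" by (simp add: wint_def)
  then have "AE t in \<mu>. ennreal (\<omega> t powr p) * indicator K t = 0"
    by (subst (asm) nn_integral_0_iff_AE) auto
  then have "AE t in \<mu>. t \<notin> K"
  proof (eventually_elim)
    case (elim t)
    have "\<omega> t powr p > 0" using pos[of t] by simp
    then have "ennreal (\<omega> t powr p) \<noteq> 0" by simp
    then show ?case using elim by (auto simp: indicator_def)
  qed
  then have "emeasure \<mu> K = 0"
    using K(1) sets_eq AE_iff_measurable[of K \<mu> "\<lambda>t. t \<notin> K"] by simp
  then show False using K(2) by simp
qed

text \<open>Inner regularity of the measure on the open set \<open>UNIV\<close>, whose measure is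
  nonzero.\<close>

lemma compact_pos_measure:
  obtains K where "compact K" "0 < emeasure \<mu> K"
proof -
  have "emeasure \<mu> UNIV = (SUP K\<in>{K. compact K \<and> K \<subseteq> UNIV}. emeasure \<mu> K)" "emeasure \<mu> UNIV \<noteq> 0"
    using haar space_eq unfolding left_haar_measure_def by (metis open_UNIV)+
  then have "0 < (SUP K\<in>{K. compact K \<and> K \<subseteq> UNIV}. emeasure \<mu> K)" by (metis zero_less_iff_neq_zero)
  then show ?thesis using that unfolding less_SUP_iff by blast
qed

text \<open>A translate of \<open>K\<close> by \<open>x\<close> meets \<open>W\<close> only if
  \<open>x\<close> lies in the compact set \<open>W - K\<close>, which cannot be the whole
  noncompact group.\<close>

lemma translate_avoids_compact:
  assumes nc: "\<not> compact (UNIV :: 'a set)" and K: "compact (K :: 'a set)" and W: "compact W"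
  obtains x where "((+) x ` K) \<inter> W = {}"
proof -
  have "compact ((\<lambda>(x, y). x + y) ` (W \<times> uminus ` K))"
    by (intro compact_sum_group compact_uminus_group K W)
  then obtain x where x: "x \<notin> (\<lambda>(x, y). x + y) ` (W \<times> uminus ` K)" using nc by (metis UNIV_eq_I)
  have "((+) x ` K) \<inter> W = {}"
  proof (rule ccontr)
    assume "((+) x ` K) \<inter> W \<noteq> {}"
    then obtain k where k: "k \<in> K" "x + k \<in> W" by auto
    have "x = (x + k) + - k" by (simp add: add.assoc)
    then show False using k x by force
  qed
  then show ?thesis by (rule that)
qed

text \<open>Density in the coordinates of \<open>f\<close>: the translation is moved from
  \<open>f\<close> to the target \<open>g\<close>, so that different \<open>s\<close> are compared
  through one fixed function \<open>f\<close>.\<close>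

lemma dense_vector_approx:
  assumes d: "dense_vector \<mu> p \<omega> \<Lambda> S f" and g: "g \<in> weighted_Lp \<mu> p \<omega>" and k: "0 < \<kappa>"
  obtains c s where "c \<in> \<Lambda>" "s \<in> S" "wint UNIV s (\<lambda>t. c * f t - g (s + t)) < ennreal \<kappa>"
proof -
  have [measurable]: "f \<in> borel_measurable borel" "g \<in> borel_measurable borel"
    using d g by (auto simp: dense_vector_def weighted_Lp_iff)
  obtain c s where cs: "c \<in> \<Lambda>" "s \<in> S" "wint UNIV 0 (\<lambda>t. c * left_translation s f t - g t) < ennreal \<kappa>"
    using d g k unfolding dense_vector_def dense_in_weighted_Lp_iff by blast
  have "wint UNIV 0 (\<lambda>t. c * f (- s + t) - g t) = wint UNIV s (\<lambda>t. c * f (- s + (s + t)) - g (s + t))"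
    using wint_translate[of UNIV "\<lambda>t. c * f (- s + t) - g t" s] by simp
  then have "wint UNIV s (\<lambda>t. c * f t - g (s + t)) < ennreal \<kappa>"
    using cs(3) by (simp add: left_translation_def add.assoc[symmetric])
  then show ?thesis using cs that by blast
qed

text \<open>If \<open>f\<close> vanished almost everywhere, boundedness of translations would make
  every \<open>c T_s f\<close> null as well, and the indicator of a compact set of positive measure
  could not be approximated.\<close>

lemma dense_vector_nonzero:
  assumes d: "dense_vector \<mu> p \<omega> \<Lambda> S f"
  shows "0 < wint UNIV 0 f"
proof (rule ccontr)
  assume "\<not> ?thesis"
  then have 0: "wint UNIV 0 f = 0" by simp
  have [measurable]: "f \<in> borel_measurable borel"
    using d by (auto simp: dense_vector_def weighted_Lp_iff)
  obtain K where K: "compact K" "0 < emeasure \<mu> K" using compact_pos_measure by blast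
  note sets_compact[OF K(1), measurable]
  define k where "k = enn2real (wint K 0 (\<lambda>_. 1))"
  have k: "wint K 0 (\<lambda>_. 1) = ennreal k" "0 < k"
    using wint_const_finite[OF K(1), of 1] wint_one_pos[OF _ K(2)]
      by (auto simp: k_def enn2real_positive_iff)
  define g where "g t = (if t \<in> K then 1 else 0 :: complex)" for t
  have [measurable]: "g \<in> borel_measurable borel" unfolding g_def by measurable
  have g: "wint UNIV 0 g = ennreal k"
    using wint_restrict[of K UNIV g 0] wint_cong[of K g "\<lambda>_. 1" 0] k by (simp add: g_def)
  then have gL: "g \<in> weighted_Lp \<mu> p \<omega>" by (simp add: weighted_Lp_iff)
  \<comment> \<open>After the factor \<open>2 powr p\<close> of the triangle inequality this
    tolerance becomes \<open>k / 2\<close>, which is less than \<open>k\<close>.\<close>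
  have "0 < k / (2 * 2 powr p)" using k by simp
  from dense_vector_approx[OF d gL this]
  obtain c s where cs: "wint UNIV s (\<lambda>t. c * f t - g (s + t)) < ennreal (k / (2 * 2 powr p))"
    by blast
  obtain C where "\<forall>t. \<omega> (s + t) \<le> C * \<omega> t" using left_quot by blast
  then have C: "\<omega> (s + t) \<le> max C 1 * \<omega> t" for t
    using pos[of t] mult_right_mono[of C "max C 1" "\<omega> t"]
      by (meson less_imp_le max.cobounded1 order_trans)
  have "wint UNIV s f \<le> ennreal (max C 1 powr p) * wint UNIV 0 f"
    using C by (intro wint_left_le) auto
  then have "wint UNIV s f = 0" using 0 by simp
  then have f0: "wint UNIV s (\<lambda>t. c * f t - 0) = 0" using wint_cmult[of UNIV f s c] by simp
  have "ennreal k = wint UNIV s (\<lambda>t. g (s + t) - 0)"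
    using wint_translate[of UNIV g s] g by simp
  also have "\<dots> \<le> ennreal (2 powr p)
    * (wint UNIV s (\<lambda>t. g (s + t) - c * f t) + wint UNIV s (\<lambda>t. c * f t - 0))"
    by (rule wint_diff_triangle) auto
  also have "\<dots> = ennreal (2 powr p) * wint UNIV s (\<lambda>t. c * f t - g (s + t))"
    by (simp only: f0 wint_swap[of UNIV s "\<lambda>t. g (s + t)"]) simp
  also have "\<dots> \<le> ennreal (2 powr p) * ennreal (k / (2 * 2 powr p))"
    using cs by (intro mult_left_mono) auto
  also have "\<dots> = ennreal (k / 2)" by (simp add: ennreal_mult'[symmetric])
  finally show False using k by (simp add: ennreal_le_iff2)
qed

text \<open>The choices are ordered to avoid circularity: the masses \<open>k\<close> and
  \<open>\<alpha>\<close>, the bump size \<open>e\<close>, the sets \<open>L\<close> and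
  \<open>Q\<close>, the ratio \<open>\<theta>\<close> and the set \<open>W\<close> are all fixed
  before the far translate \<open>K'\<close>, and only its height \<open>\<eta>\<close> is adapted
  to \<open>K'\<close>. The scalar \<open>c\<close> is controlled at no point in advance; each
  estimate is homogeneous in it.\<close>

lemma dense_vector_necessary:
  assumes nc: "\<not> compact (UNIV :: 'a set)" and d: "dense_vector \<mu> p \<omega> \<Lambda> S f" and \<epsilon>: "0 < \<epsilon>"
  shows "\<exists>s\<in>S. \<exists>c\<in>\<Lambda>. norm c * \<omega> s < \<epsilon> \<and> \<omega> (- s) < \<epsilon> * norm c"
proof -
  have f [measurable]: "f \<in> borel_measurable borel" and fin: "wint UNIV 0 f < \<infinity>"
    using d by (auto simp: dense_vector_def weighted_Lp_iff)
  define P where "P = 2 powr p"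
  have P: "0 < P" by (simp add: P_def)
  obtain K where K: "compact K" "0 < emeasure \<mu> K" using compact_pos_measure by blast
  note sets_compact[OF K(1), measurable]
  define k where "k = enn2real (wint K 0 (\<lambda>_. 1))"
  have k: "wint K 0 (\<lambda>_. 1) = ennreal k" "0 < k"
    using wint_const_finite[OF K(1), of 1] wint_one_pos[OF _ K(2)]
      by (auto simp: k_def enn2real_positive_iff)

  \<comment> \<open>\<open>A\<close> is a compact set with a positive share \<open>\<alpha>\<close>
    of the mass of \<open>f\<close>.\<close>
  obtain A where A: "compact A" "wint (- A) 0 f < wint UNIV 0 f"
    using wint_tail[OF f fin dense_vector_nonzero[OF d]] by blast
  note sets_compact[OF A(1), measurable]
  define \<alpha> where "\<alpha> = enn2real (wint A 0 f)"
  have \<alpha>: "wint A 0 f = ennreal \<alpha>" "0 < \<alpha>"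
  proof -
    have "wint A 0 f < \<infinity>" using fin wint_mono_set[of A UNIV 0 f] by (simp add: order_le_less_trans)
    moreover have "wint A 0 f \<noteq> 0" using wint_split[of A f 0] A(2) by auto
    ultimately show "wint A 0 f = ennreal \<alpha>" "0 < \<alpha>"
      by (auto simp: \<alpha>_def enn2real_positive_iff zero_less_iff_neq_zero)
  qed
  obtain B\<^sub>A where BA: "0 < B\<^sub>A" "\<And>t. t \<in> A \<Longrightarrow> \<omega> t \<le> B\<^sub>A" using weight_le_on_compact[OF A(1)] by blast
  obtain C\<^sub>A where CA: "0 < C\<^sub>A" "\<And>t s. t \<in> A \<Longrightarrow> \<omega> s \<le> C\<^sub>A * \<omega> (s + t)"
    using right_bound_lower[OF A(1)] by blast
  obtain B\<^sub>K where BK: "0 < B\<^sub>K" "\<And>t. t \<in> K \<Longrightarrow> \<omega> t \<le> B\<^sub>K" using weight_le_on_compact[OF K(1)] by blast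
  obtain C\<^sub>K where CK: "0 < C\<^sub>K" "\<And>t s. t \<in> K \<Longrightarrow> \<omega> s \<le> C\<^sub>K * \<omega> (s + t)"
    using right_bound_lower[OF K(1)] by blast
  \<comment> \<open>These are the \<open>p\<close>-th powers of the constants in \<open>\<omega> t *
    \<omega> s \<le> B\<^sub>A * C\<^sub>A * \<omega> (s + t)\<close> for \<open>t\<close> in
    \<open>A\<close>, and in \<open>\<omega> (s + t) * \<omega> (- s) \<le> B\<^sub>K * C\<^sub>K *
    \<omega> t\<close> for \<open>s + t\<close> in \<open>K\<close>.\<close>
  define D where "D = (B\<^sub>A * C\<^sub>A) powr p"
  define D' where "D' = (B\<^sub>K * C\<^sub>K) powr p"
  have D: "0 < D" "0 < D'" using BA BK CA CK by (auto simp: D_def D'_def)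

  \<comment> \<open>Calibrated for the two final estimates: \<open>D * P * (2 * e)\<close> equals
    half of \<open>\<epsilon> powr p * \<alpha>\<close>, and a mass \<open>\<delta>\<close> of
    \<open>f\<close> contributes \<open>k / 4\<close> times the ratio of
    \<open>(\<epsilon> * norm c) powr p\<close> to \<open>\<omega> (- s) powr p\<close>.\<close>
  define e where "e = \<epsilon> powr p * \<alpha> / (4 * D * P)"
  define \<delta> where "\<delta> = k * \<epsilon> powr p / (4 * P * D')"
  have e: "0 < e" and \<delta>: "0 < \<delta>" using \<epsilon> \<alpha> k D P by (auto simp: e_def \<delta>_def)
  obtain L where L: "compact L" "wint (- L) 0 f < ennreal \<delta>"
    using wint_tail[OF f fin, of "ennreal \<delta>"] \<delta> by auto
  \<comment> \<open>\<open>s\<close> lies outside \<open>Q\<close> exactly when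
    \<open>- s + K\<close> misses both \<open>A\<close> and \<open>L\<close>.\<close>
  define Q where "Q = (\<lambda>(x, y). x + y) ` (K \<times> uminus ` (A \<union> L))"
  have Q: "compact Q"
    unfolding Q_def by (intro compact_sum_group compact_uminus_group compact_Un K A L)
  \<comment> \<open>\<open>P * (2 * e + k)\<close> will bound the mass of \<open>c T_s f\<close> on
    \<open>W\<close>; times \<open>\<theta>\<close> this is \<open>e / (4 * P)\<close>, too little
    to produce the far bump.\<close>
  define \<theta> where "\<theta> = e / (4 * P * P * (2 * e + k))"
  have \<theta>: "0 < \<theta>" using e P k by (auto simp: \<theta>_def intro!: divide_pos_pos mult_pos_pos)
  obtain W where W: "compact W"
    "\<And>s. s \<in> Q \<Longrightarrow> wint (- ((\<lambda>t. s + t) -` W)) s f \<le> ennreal \<theta> * wint ((\<lambda>t. s + t) -` W) s f"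
    using translates_uniform_tail[OF f fin Q \<theta>] by blast
  note sets_compact[OF W(1), measurable]

  obtain x where x: "((+) x ` K) \<inter> (W \<union> K) = {}"
    using translate_avoids_compact[OF nc K(1) compact_Un[OF W(1) K(1)]] by blast
  define K' where "K' = (+) x ` K"
  have K': "compact K'" "0 < emeasure \<mu> K'" "K' \<inter> W = {}" "K' \<inter> K = {}"
  proof -
    show "compact K'" unfolding K'_def
      by (intro compact_continuous_image K continuous_on_add continuous_on_const continuous_on_id)
    show "0 < emeasure \<mu> K'" unfolding K'_def using K by (simp add: emeasure_translate)
  qed (use x in \<open>auto simp: K'_def\<close>)
  note sets_compact[OF K'(1), measurable]
  define k' where "k' = enn2real (wint K' 0 (\<lambda>_. 1))"
  have k': "wint K' 0 (\<lambda>_. 1) = ennreal k'" "0 < k'"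
    using wint_const_finite[OF K'(1), of 1] wint_one_pos[OF _ K'(2)]
      by (auto simp: k'_def enn2real_positive_iff)
  define \<eta> where "\<eta> = (e / k') powr (1 / p)"
  have \<eta>: "\<eta> powr p * k' = e" using e k' p0 by (simp add: \<eta>_def powr_powr)
  \<comment> \<open>The far bump has size \<open>e\<close>, fixed before \<open>x\<close> and hence before \<open>K'\<close>.\<close>
  define h where "h t = (if t \<in> K then 1 else if t \<in> K' then of_real \<eta> else 0 :: complex)" for t
  have [measurable]: "h \<in> borel_measurable borel" unfolding h_def by measurable
  have hK: "wint K 0 h = ennreal k"
    using wint_cong[of K h "\<lambda>_. 1" 0] k by (simp add: h_def)
  have hK': "wint K' 0 h = ennreal e"
  proof -
    have "wint K' 0 h = wint K' 0 (\<lambda>t. of_real \<eta> * 1)"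
      using K'(4) by (intro wint_cong) (auto simp: h_def)
    also have "\<dots> = ennreal (\<eta> powr p) * ennreal k'"
      by (subst wint_cmult) (auto simp: k' \<eta>_def)
    finally show ?thesis using \<eta> by (simp add: ennreal_mult'[symmetric])
  qed
  have hnK: "wint (- K) 0 h = ennreal e"
    using wint_restrict[of K' "- K" h 0] K'(4) hK' by (auto simp: h_def)
  have hU: "wint UNIV 0 h = ennreal (k + e)"
    using wint_split[of K h 0] hK hnK k e by (simp add: ennreal_plus[symmetric] del: ennreal_plus)
  then have hLp: "h \<in> weighted_Lp \<mu> p \<omega>" by (simp add: weighted_Lp_iff)
  \<comment> \<open>Three demands on the error: at most \<open>e\<close> when bounding
    \<open>c T_s f\<close> from above, \<open>e / (4 * P)\<close> for the contradiction on
    \<open>K'\<close>, and \<open>k / (2 * P)\<close> for the lower estimate on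
    \<open>K\<close>.\<close>
  define \<kappa> where "\<kappa> = min e (min (e / (4 * P)) (k / (2 * P)))"
  have \<kappa>: "0 < \<kappa>" using e k P by (auto simp: \<kappa>_def)
  obtain c s where cs: "c \<in> \<Lambda>" "s \<in> S" and app: "wint UNIV s (\<lambda>t. c * f t - h (s + t)) < ennreal \<kappa>"
    using dense_vector_approx[OF d hLp \<kappa>] by blast
  \<comment> \<open>From here on everything is read at base point \<open>s\<close>:
    \<open>hs\<close> is the target, \<open>v\<close> the approximating function, and
    \<open>T E\<close> is \<open>E\<close> translated back by \<open>s\<close>.\<close>
  define hs where "hs t = h (s + t)" for t
  define v where "v t = c * f t" for t
  define T where "T E = (\<lambda>t. s + t) -` E" for E
  have Tm [measurable]: "E \<in> sets borel \<Longrightarrow> T E \<in> sets borel" for E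
    unfolding T_def using measurable_sets[OF measurable_translate, of E s] by simp
  have [measurable]: "hs \<in> borel_measurable borel" "v \<in> borel_measurable borel"
    unfolding hs_def v_def by measurable
  have hs: "wint (T E) s hs = wint E 0 h" if "E \<in> sets borel" for E
    unfolding hs_def T_def using wint_translate[OF that, of h s] by simp
  have vf: "wint E s v = ennreal (norm c powr p) * wint E s f" if "E \<in> sets borel" for E
    unfolding v_def by (rule wint_cmult[OF that]) measurable
  have app': "wint E s (\<lambda>t. v t - hs t) \<le> ennreal \<kappa>" for E
    using app wint_mono_set[of E UNIV s "\<lambda>t. v t - hs t"] unfolding v_def hs_def by auto
  have v_le: "wint E s v \<le> ennreal P * (ennreal \<kappa> + wint E s hs)" if E [measurable]: "E \<in> sets borel"
    for E
  proof -
    have "wint E s v \<le> ennreal P * (wint E s (\<lambda>t. v t - hs t) + wint E s (\<lambda>t. hs t - 0))"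
      using wint_diff_triangle[of E v hs "\<lambda>_. 0" s] by (simp add: P_def)
    also have "\<dots> \<le> ennreal P * (ennreal \<kappa> + wint E s hs)"
      using app' by (intro mult_left_mono add_mono) auto
    finally show ?thesis .
  qed
  have hs_le: "wint E s hs \<le> ennreal P * (ennreal \<kappa> + wint E s v)" if E [measurable]: "E \<in> sets borel"
    for E
  proof -
    have "wint E s hs \<le> ennreal P * (wint E s (\<lambda>t. hs t - v t) + wint E s (\<lambda>t. v t - 0))"
      using wint_diff_triangle[of E hs v "\<lambda>_. 0" s] by (simp add: P_def)
    also have "\<dots> \<le> ennreal P * (ennreal \<kappa> + wint E s v)"
      using app' wint_swap[of E s hs v] by (intro mult_left_mono add_mono) auto
    finally show ?thesis .
  qed

  \<comment> \<open>For \<open>s\<close> in \<open>Q\<close> the uniform tail bound leaves at most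
    \<open>e / (4 * P)\<close> of the mass off \<open>W\<close>, hence on \<open>K'\<close>. The
    target has mass \<open>e\<close> on \<open>K'\<close>, and the triangle inequality would give
    \<open>e \<le> e / 2\<close>.\<close>
  have sQ: "s \<notin> Q"
  proof
    assume "s \<in> Q"
    have TW: "T W \<in> sets borel" "- T W \<in> sets borel" "T K' \<in> sets borel" by measurable
    have "wint (T W) s v \<le> ennreal P * (ennreal \<kappa> + wint UNIV s hs)"
      using v_le[OF TW(1)] wint_mono_set[of "T W" UNIV s hs]
      by (meson add_left_mono mult_left_mono order_trans subset_UNIV zero_le)
    also have "wint UNIV s hs = ennreal (k + e)"
      using hs[of UNIV] hU by (simp add: T_def)
    also have "ennreal P * (ennreal \<kappa> + ennreal (k + e)) = ennreal (P * (\<kappa> + (k + e)))"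
      using P \<kappa> k e by (simp add: ennreal_mult'[symmetric] ennreal_plus[symmetric] del: ennreal_plus)
    also have "\<dots> \<le> ennreal (P * (2 * e + k))"
      using P by (intro ennreal_leI mult_left_mono) (auto simp: \<kappa>_def)
    finally have 1: "wint (T W) s v \<le> ennreal (P * (2 * e + k))" .
    have "T K' \<subseteq> - T W" using K'(3) by (auto simp: T_def)
    then have "wint (T K') s v \<le> wint (- T W) s v" by (rule wint_mono_set)
    also have "\<dots> = ennreal (norm c powr p) * wint (- T W) s f" by (rule vf) fact
    also have "\<dots> \<le> ennreal (norm c powr p) * (ennreal \<theta> * wint (T W) s f)"
      using W(2)[OF \<open>s \<in> Q\<close>] by (intro mult_left_mono) (auto simp: T_def)
    also have "\<dots> = ennreal \<theta> * wint (T W) s v" using vf[OF TW(1)] by (simp add: mult_ac)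
    also have "\<dots> \<le> ennreal \<theta> * ennreal (P * (2 * e + k))" by (intro mult_left_mono 1) auto
    also have "\<dots> = ennreal (e / (4 * P))"
      using \<theta> P e k by (simp add: ennreal_mult'[symmetric] \<theta>_def)
    finally have 2: "wint (T K') s v \<le> ennreal (e / (4 * P))" .
    have "ennreal e = wint (T K') s hs" using hs[of K'] hK' by simp
    also have "\<dots> \<le> ennreal P * (ennreal \<kappa> + wint (T K') s v)" by (rule hs_le) fact
    also have "\<dots> \<le> ennreal P * (ennreal (e / (4 * P)) + ennreal (e / (4 * P)))"
      using 2 by (intro mult_left_mono add_mono ennreal_leI) (auto simp: \<kappa>_def)
    also have "\<dots> = ennreal (e / 2)"
      using P e by (simp add: ennreal_mult'[symmetric] ennreal_plus[symmetric]
        field_simps del: ennreal_plus)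
    finally show False using e by (simp add: ennreal_le_iff2)
  qed

  have AT: "A \<subseteq> - T K"
  proof
    fix t assume "t \<in> A"
    show "t \<in> - T K"
    proof
      assume "t \<in> T K"
      then have "s + t \<in> K" by (simp add: T_def)
      moreover have "s = (s + t) + - t" by (simp add: add.assoc)
      ultimately have "s \<in> Q" unfolding Q_def using \<open>t \<in> A\<close> by force
      then show False using sQ by simp
    qed
  qed
  have LT: "T K \<subseteq> - L"
  proof
    fix t assume "t \<in> T K"
    show "t \<in> - L"
    proof
      assume "t \<in> L"
      have "s + t \<in> K" using \<open>t \<in> T K\<close> by (simp add: T_def)
      moreover have "s = (s + t) + - t" by (simp add: add.assoc)
      ultimately have "s \<in> Q" unfolding Q_def using \<open>t \<in> L\<close> by force
      then show False using sQ by simp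
    qed
  qed

  \<comment> \<open>The translate \<open>s + A\<close> misses \<open>K\<close>, so the target has
    there at most the mass \<open>e\<close> of the far bump. The mass of \<open>c T_s f\<close> on
    it is at least \<open>(norm c * \<omega> s) powr p * \<alpha> / D\<close>.\<close>
  have c1: "norm c * \<omega> s < \<epsilon>"
  proof -
    have Am: "A \<in> sets borel" "- T K \<in> sets borel" "- K \<in> sets borel" by measurable
    have "wint A s v \<le> wint (- T K) s v" by (rule wint_mono_set) fact
    also have "\<dots> \<le> ennreal P * (ennreal \<kappa> + wint (- T K) s hs)" by (rule v_le) fact
    also have "wint (- T K) s hs = ennreal e"
      using hs[OF Am(3)] hnK by (simp add: T_def vimage_Compl)
    also have "ennreal P * (ennreal \<kappa> + ennreal e) = ennreal (P * (\<kappa> + e))"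
      using P \<kappa> e by (simp add: ennreal_mult'[symmetric] ennreal_plus[symmetric] del: ennreal_plus)
    also have "\<dots> \<le> ennreal (P * (2 * e))"
      using P by (intro ennreal_leI mult_left_mono) (auto simp: \<kappa>_def)
    finally have 1: "wint A s v \<le> ennreal (P * (2 * e))" .
    have "wint A 0 f \<le> ennreal (D / \<omega> s powr p) * wint A s f"
    proof (rule wint_le)
      fix t assume t: "t \<in> A"
      have "\<omega> t * \<omega> s \<le> B\<^sub>A * (C\<^sub>A * \<omega> (s + t))"
        using BA CA t pos by (intro mult_mono) (auto intro: less_imp_le)
      then have "(\<omega> t * \<omega> s) powr p \<le> (B\<^sub>A * (C\<^sub>A * \<omega> (s + t))) powr p"
        using p0 pos by (intro powr_mono2) (auto intro: less_imp_le)
      then have "\<omega> t powr p * \<omega> s powr p \<le> D * \<omega> (s + t) powr p"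
        by (simp add: D_def powr_mult mult_ac)
      then have "\<omega> t powr p \<le> D / \<omega> s powr p * \<omega> (s + t) powr p"
        using pos[of s] by (simp add: field_simps)
      then have "norm (f t) powr p * \<omega> t powr p
        \<le> norm (f t) powr p * (D / \<omega> s powr p * \<omega> (s + t) powr p)"
        by (intro mult_left_mono) auto
      then show "norm (f t) powr p * \<omega> (0 + t) powr p
        \<le> D / \<omega> s powr p * (norm (f t) powr p * \<omega> (s + t) powr p)"
        by (simp add: mult_ac)
    qed (use D in auto)
    then have "ennreal (norm c powr p) * ennreal \<alpha>
      \<le> ennreal (norm c powr p) * (ennreal (D / \<omega> s powr p) * wint A s f)"
      unfolding \<alpha> by (intro mult_left_mono) auto
    also have "\<dots> = ennreal (D / \<omega> s powr p) * wint A s v" using vf[OF Am(1)] by (simp add: mult_ac)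
    also have "\<dots> \<le> ennreal (D / \<omega> s powr p) * ennreal (P * (2 * e))" by (intro mult_left_mono 1) auto
    finally have "norm c powr p * \<alpha> \<le> D / \<omega> s powr p * (P * (2 * e))"
      using P e D \<alpha> by (simp add: ennreal_mult'[symmetric] ennreal_le_iff)
    then have "(norm c * \<omega> s) powr p * \<alpha> \<le> D * P * (2 * e)"
      using pos[of s] by (simp add: powr_mult field_simps)
    also have "\<dots> = \<epsilon> powr p * \<alpha> / 2" using D P by (simp add: e_def)
    also have "\<dots> < \<epsilon> powr p * \<alpha>" using \<epsilon> \<alpha> by simp
    finally have "(norm c * \<omega> s) powr p < \<epsilon> powr p" using \<alpha> by simp
    then show ?thesis using p0 \<epsilon> by (smt (verit) powr_mono2)
  qed
  \<comment> \<open>On \<open>T K\<close> the target has mass \<open>k\<close>, while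
    \<open>f\<close> has mass below \<open>\<delta>\<close> at base point 0, since
    \<open>T K\<close> avoids \<open>L\<close>. Reaching \<open>k\<close> from so little mass forces
    \<open>\<omega> (- s)\<close> to be small against \<open>norm c\<close>.\<close>
  have c2: "\<omega> (- s) < \<epsilon> * norm c"
  proof -
    have TK: "T K \<in> sets borel" by measurable
    have "wint (T K) s f \<le> ennreal (D' / \<omega> (- s) powr p) * wint (T K) 0 f"
    proof (rule wint_le)
      fix t assume "t \<in> T K"
      then have st: "s + t \<in> K" by (simp add: T_def)
      have "\<omega> (- s) \<le> C\<^sub>K * \<omega> (- s + (s + t))" using CK(2)[OF st] by blast
      then have "\<omega> (- s) \<le> C\<^sub>K * \<omega> t" by (simp add: add.assoc[symmetric])
      then have "\<omega> (s + t) * \<omega> (- s) \<le> B\<^sub>K * (C\<^sub>K * \<omega> t)"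
        using BK st pos by (intro mult_mono) (auto intro: less_imp_le)
      then have "(\<omega> (s + t) * \<omega> (- s)) powr p \<le> (B\<^sub>K * (C\<^sub>K * \<omega> t)) powr p"
        using p0 pos by (intro powr_mono2) (auto intro: less_imp_le)
      then have "\<omega> (s + t) powr p * \<omega> (- s) powr p \<le> D' * \<omega> t powr p"
        by (simp add: D'_def powr_mult mult_ac)
      then have "\<omega> (s + t) powr p \<le> D' / \<omega> (- s) powr p * \<omega> t powr p"
        using pos[of "- s"] by (simp add: field_simps)
      then have "norm (f t) powr p * \<omega> (s + t) powr p
        \<le> norm (f t) powr p * (D' / \<omega> (- s) powr p * \<omega> t powr p)"
        by (intro mult_left_mono) auto
      then show "norm (f t) powr p * \<omega> (s + t) powr p
        \<le> D' / \<omega> (- s) powr p * (norm (f t) powr p * \<omega> (0 + t) powr p)"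
        by (simp add: mult_ac)
    qed (use D in auto)
    also have "\<dots> \<le> ennreal (D' / \<omega> (- s) powr p) * ennreal \<delta>"
      using L(2) wint_mono_set[OF LT, of 0 f] by (intro mult_left_mono) auto
    finally have 1: "wint (T K) s f \<le> ennreal (D' / \<omega> (- s) powr p) * ennreal \<delta>" .
    have "ennreal k = wint (T K) s hs" using hs[of K] hK by simp
    also have "\<dots> \<le> ennreal P * (ennreal \<kappa> + wint (T K) s v)" by (rule hs_le) fact
    also have "wint (T K) s v = ennreal (norm c powr p) * wint (T K) s f" by (rule vf) fact
    also have "ennreal P * (ennreal \<kappa> + ennreal (norm c powr p) * wint (T K) s f)
        \<le> ennreal P * (ennreal \<kappa> + ennreal (norm c powr p) *
        (ennreal (D' / \<omega> (- s) powr p) * ennreal \<delta>))"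
      by (intro mult_left_mono add_left_mono 1) auto
    also have "\<dots> = ennreal (P * (\<kappa> + norm c powr p * (D' / \<omega> (- s) powr p * \<delta>)))"
      using P \<kappa> D \<delta> by (simp add: ennreal_mult'[symmetric] ennreal_plus[symmetric] del: ennreal_plus)
    finally have "k \<le> P * (\<kappa> + norm c powr p * (D' / \<omega> (- s) powr p * \<delta>))"
      using P \<kappa> D \<delta> by (subst (asm) ennreal_le_iff) auto
    then have "k \<le> P * \<kappa> + P * norm c powr p * (D' / \<omega> (- s) powr p * \<delta>)"
      by (simp add: distrib_left mult_ac)
    moreover have "P * \<kappa> \<le> P * (k / (2 * P))" unfolding \<kappa>_def using P by (intro mult_left_mono) auto
    then have "P * \<kappa> \<le> k / 2" using P by simp
    moreover have "P * norm c powr p * (D' / \<omega> (- s) powr p * \<delta>)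
      = k / 4 * ((\<epsilon> * norm c) powr p / \<omega> (- s) powr p)"
      using P D \<epsilon> by (simp add: \<delta>_def powr_mult mult_ac)
    ultimately have "k \<le> k / 2 + k / 4 * ((\<epsilon> * norm c) powr p / \<omega> (- s) powr p)" by linarith
    moreover have "2 \<le> X" if "k \<le> k / 2 + k / 4 * X" for X :: real
    proof -
      have "k * 2 \<le> k * X" using that by (simp add: field_simps)
      then show ?thesis using k(2) by simp
    qed
    ultimately have "2 \<le> (\<epsilon> * norm c) powr p / \<omega> (- s) powr p" by blast
    then have "2 * \<omega> (- s) powr p \<le> (\<epsilon> * norm c) powr p" using pos[of "- s"] by (simp add: field_simps)
    moreover have "0 < \<omega> (- s) powr p" using pos[of "- s"] by simp
    ultimately have "\<omega> (- s) powr p < (\<epsilon> * norm c) powr p" by linarith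
    then show ?thesis using p0 \<epsilon> pos[of "- s"]
      by (smt (verit) powr_mono2 mult_nonneg_nonneg norm_ge_zero)
  qed
  show ?thesis using cs c1 c2 by blast
qed

end

section \<open>A countable dense set of compactly supported functions\<close>

text \<open>Linear combinations of indicators are coded by lists: lists over a countable set are
  countable, and concatenation codes addition.\<close>

definition step_comb :: "(complex \<times> 'a set) list \<Rightarrow> 'a \<Rightarrow> complex" where
  "step_comb xs t = (\<Sum>(c, U)\<leftarrow>xs. c * indicator U t)"

lemma step_comb_simps [simp]:
  "step_comb [] t = 0"
  "step_comb ((c, U) # xs) t = c * indicator U t + step_comb xs t"
  "step_comb (xs @ ys) t = step_comb xs t + step_comb ys t"
  by (simp_all add: step_comb_def)

context weighted_group
begin

lemma wint_indicator_diff: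
  assumes "E \<subseteq> F"
  shows "wint UNIV s (\<lambda>t. c * indicator F t - c * indicator E t) = wint (F - E) s (\<lambda>_. c)"
proof -
  have "wint UNIV s (\<lambda>t. c * indicator F t - c * indicator E t)
    = wint (F - E) s (\<lambda>t. c * indicator F t - c * indicator E t)"
    using assms by (intro wint_restrict) (auto simp: indicator_def)
  also have "\<dots> = wint (F - E) s (\<lambda>_. c)" by (intro wint_cong) (auto simp: indicator_def)
  finally show ?thesis .
qed

lemma relatively_compact_neighbourhood:
  assumes K: "compact K"
  obtains V K' where "open V" "compact K'" "K \<subseteq> V" "V \<subseteq> (K' :: 'a set)"
proof -
  have "\<forall>x. \<exists>U C. open U \<and> compact C \<and> x \<in> U \<and> U \<subseteq> (C :: 'a set)"
    using lc by (simp add: locally_compact_space_def)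
  then obtain U C where UC: "\<And>x. open (U x)" "\<And>x. compact (C x)" "\<And>x. x \<in> U x"
    "\<And>x. U x \<subseteq> (C x :: 'a set)"
    by metis
  have "K \<subseteq> (\<Union>x\<in>UNIV. U x)" using UC(3) by blast
  then obtain F where F: "finite F" "K \<subseteq> (\<Union>x\<in>F. U x)"
    using compactE_image[OF K, of UNIV U] UC(1) by metis
  show ?thesis
  proof
    show "open (\<Union>x\<in>F. U x)" using UC(1) by blast
    show "compact (\<Union>x\<in>F. C x)" using UC(2) F(1) by (intro compact_UN) auto
    show "(\<Union>x\<in>F. U x) \<subseteq> (\<Union>x\<in>F. C x)" using UC(4) by (intro UN_mono) auto
  qed (fact F)
qed

text \<open>Coefficients come from a countable dense set of scalars, sets from finite unions of
  relatively compact basic open sets. Density climbs from indicators of these sets to relatively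
  compact open sets, then to relatively compact Borel sets, and by simple functions to the whole
  space.\<close>

lemma countable_dense_step_combs:
  obtains D :: "('a \<Rightarrow> complex) set" where "countable D" "D \<noteq> {}"
    "\<And>d. d \<in> D \<Longrightarrow> d \<in> borel_measurable borel"
    "\<And>d. d \<in> D \<Longrightarrow> \<exists>K B. compact K \<and> (\<forall>t. norm (d t) \<le> B) \<and> (\<forall>t. t \<notin> K \<longrightarrow> d t = 0)"
    "\<And>u \<epsilon>. u \<in> weighted_Lp \<mu> p \<omega> \<Longrightarrow> 0 < \<epsilon> \<Longrightarrow> \<exists>d\<in>D. wint UNIV 0 (\<lambda>t. d t - u t) < ennreal \<epsilon>"
proof -
  obtain C :: "complex set" where C: "countable C" "\<And>X. open X \<Longrightarrow> X \<noteq> {} \<Longrightarrow> \<exists>d\<in>C. d \<in> X"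
    by (erule countable_dense_setE)
  obtain \<B> :: "'a set set" where "countable \<B>" and basis: "topological_basis \<B>"
    using ex_countable_basis by auto
  then have \<B>: "countable \<B>" "\<And>U. U \<in> \<B> \<Longrightarrow> open U"
    "\<And>S. open S \<Longrightarrow> \<exists>U. U \<subseteq> \<B> \<and> S = \<Union>U"
    by (auto simp: topological_basis_def)
  define \<U> where "\<U> = {U \<in> \<B>. \<exists>K. compact K \<and> U \<subseteq> K}"
  \<comment> \<open>Closing under finite unions lets an increasing sequence in \<open>\<F>\<close>
    exhaust a relatively compact open set.\<close>
  define \<F> where "\<F> = Union ` {F. finite F \<and> F \<subseteq> \<U>}"
  have "countable \<U>" unfolding \<U>_def using \<B>(1) by (rule countable_subset[rotated]) auto
  then have cF: "countable \<F>" unfolding \<F>_def by (intro countable_image countable_Collect_finite_subset)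
  have oF: "open U" if "U \<in> \<F>" for U using that \<B>(2) unfolding \<F>_def \<U>_def by (auto intro!: open_Union)
  have kF: "\<exists>K. compact K \<and> U \<subseteq> K" if U: "U \<in> \<F>" for U
  proof -
    obtain F where F: "finite F" "F \<subseteq> \<U>" "U = \<Union>F" using U unfolding \<F>_def by auto
    then have "\<forall>V\<in>F. \<exists>K. compact K \<and> V \<subseteq> K" by (auto simp: \<U>_def)
    then obtain k where k: "\<And>V. V \<in> F \<Longrightarrow> compact (k V) \<and> V \<subseteq> k V" by metis
    have "compact (\<Union>V\<in>F. k V)" using F(1) k by (intro compact_UN) auto
    moreover have "U \<subseteq> (\<Union>V\<in>F. k V)" using k F(3) by blast
    ultimately show ?thesis by blast
  qed
  define L where "L = lists (C \<times> \<F>)"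
  define D where "D = step_comb ` L"
  have Lapp: "xs @ ys \<in> L" if "xs \<in> L" "ys \<in> L" for xs ys using that by (simp add: L_def)
  have Lm: "step_comb xs \<in> borel_measurable borel" if "xs \<in> L" for xs
    using that
  proof (induction xs)
    case (Cons x xs)
    obtain c U where x: "x = (c, U)" by force
    have U: "U \<in> sets borel" using Cons.prems oF by (auto simp: L_def x)
    have "step_comb xs \<in> borel_measurable borel" using Cons by (auto simp: L_def)
    then have "(\<lambda>t. c * indicator U t + step_comb xs t) \<in> borel_measurable borel"
      using U by measurable
    moreover have "step_comb (x # xs) = (\<lambda>t. c * indicator U t + step_comb xs t)"
      by (rule ext) (simp add: x)
    ultimately show ?case by simp
  next
    case Nil
    have "step_comb [] = (\<lambda>_ :: 'a. 0)" by (rule ext) simp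
    then show ?case by simp
  qed

  \<comment> \<open>\<open>cl\<close> is the closure of the coded functions; the facts below close
    it under limits and sums.\<close>
  define cl where "cl u \<longleftrightarrow> u \<in> borel_measurable borel \<and>
    (\<forall>\<epsilon>>0. \<exists>xs\<in>L. wint UNIV 0 (\<lambda>t. step_comb xs t - u t) < ennreal \<epsilon>)" for u
  have clm: "u \<in> borel_measurable borel" if "cl u" for u using that by (simp add: cl_def)
  have small: "0 < \<epsilon> / (2 * 2 powr p)" if "0 < \<epsilon>" for \<epsilon> :: real using that by simp
  have halves: "ennreal (2 powr p) * (a + b) < ennreal \<epsilon>"
    if "0 < \<epsilon>" "a < ennreal (\<epsilon> / (2 * 2 powr p))" "b < ennreal (\<epsilon> / (2 * 2 powr p))" for a b \<epsilon>
  proof -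
    have "a + b < ennreal (\<epsilon> / (2 * 2 powr p)) + ennreal (\<epsilon> / (2 * 2 powr p))"
      using that by (intro add_strict_mono)
    also have "\<dots> = ennreal (\<epsilon> / 2 powr p)"
      using that by (simp add: ennreal_plus[symmetric] field_simps del: ennreal_plus)
    finally have "ennreal (2 powr p) * (a + b) < ennreal (2 powr p) * ennreal (\<epsilon> / 2 powr p)"
      by (intro ennreal_mult_strict_left_mono) auto
    then show ?thesis by (simp add: ennreal_mult'[symmetric])
  qed
  have cl_lim: "cl u" if u [measurable]: "u \<in> borel_measurable borel"
    and ex: "\<And>\<epsilon>. 0 < \<epsilon> \<Longrightarrow> \<exists>v. cl v \<and> wint UNIV 0 (\<lambda>t. v t - u t) < ennreal \<epsilon>" for u
    unfolding cl_def
  proof (intro conjI allI impI u)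
    fix \<epsilon> :: real assume e: "0 < \<epsilon>"
    obtain v where v: "cl v" "wint UNIV 0 (\<lambda>t. v t - u t) < ennreal (\<epsilon> / (2 * 2 powr p))"
      using ex[OF small[OF e]] by blast
    obtain xs where xs: "xs \<in> L" "wint UNIV 0 (\<lambda>t. step_comb xs t - v t) < ennreal (\<epsilon> / (2 * 2 powr p))"
      using v(1) small[OF e] unfolding cl_def by blast
    have "wint UNIV 0 (\<lambda>t. step_comb xs t - u t) \<le> ennreal (2 powr p) *
        (wint UNIV 0 (\<lambda>t. step_comb xs t - v t) + wint UNIV 0 (\<lambda>t. v t - u t))"
      using Lm[OF xs(1)] clm[OF v(1)] by (intro wint_diff_triangle) auto
    also have "\<dots> < ennreal \<epsilon>" by (rule halves[OF e xs(2) v(2)])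
    finally show "\<exists>xs\<in>L. wint UNIV 0 (\<lambda>t. step_comb xs t - u t) < ennreal \<epsilon>" using xs(1) by blast
  qed
  have cl_seq: "cl u" if u: "u \<in> borel_measurable borel" and v: "\<And>n. cl (v n)"
    and lim: "(\<lambda>n. wint UNIV 0 (\<lambda>t. v n t - u t)) \<longlonglongrightarrow> 0" for u and v :: "nat \<Rightarrow> 'a \<Rightarrow> complex"
  proof (rule cl_lim[OF u])
    fix \<epsilon> :: real assume "0 < \<epsilon>"
    then have "eventually (\<lambda>n. wint UNIV 0 (\<lambda>t. v n t - u t) < ennreal \<epsilon>) sequentially"
      using order_tendstoD(2)[OF lim, of "ennreal \<epsilon>"] by simp
    then show "\<exists>v. cl v \<and> wint UNIV 0 (\<lambda>t. v t - u t) < ennreal \<epsilon>"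
      using v unfolding eventually_sequentially by blast
  qed
  have cl_0: "cl (\<lambda>_. 0)"
    unfolding cl_def by (auto intro!: bexI[of _ "[]"] simp: L_def wint_def p0)
  have cl_add: "cl (\<lambda>t. u t + v t)" if u: "cl u" and v: "cl v" for u v
    unfolding cl_def
  proof (intro conjI allI impI)
    show "(\<lambda>t. u t + v t) \<in> borel_measurable borel" using clm[OF u] clm[OF v] by measurable
    fix \<epsilon> :: real assume e: "0 < \<epsilon>"
    obtain xs where xs: "xs \<in> L" "wint UNIV 0 (\<lambda>t. step_comb xs t - u t) < ennreal (\<epsilon> / (2 * 2 powr p))"
      using u small[OF e] unfolding cl_def by blast
    obtain ys where ys: "ys \<in> L" "wint UNIV 0 (\<lambda>t. step_comb ys t - v t) < ennreal (\<epsilon> / (2 * 2 powr p))"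
      using v small[OF e] unfolding cl_def by blast
    have "wint UNIV 0 (\<lambda>t. step_comb (xs @ ys) t - (u t + v t)) =
      wint UNIV 0 (\<lambda>t. (step_comb xs t - u t) + (step_comb ys t - v t))" by (simp add: algebra_simps)
    also have "\<dots> \<le> ennreal (2 powr p) *
        (wint UNIV 0 (\<lambda>t. step_comb xs t - u t) + wint UNIV 0 (\<lambda>t. step_comb ys t - v t))"
      using Lm[OF xs(1)] Lm[OF ys(1)] clm[OF u] clm[OF v] by (intro wint_add) auto
    also have "\<dots> < ennreal \<epsilon>" by (rule halves[OF e xs(2) ys(2)])
    finally show "\<exists>xs\<in>L. wint UNIV 0 (\<lambda>t. step_comb xs t - (u t + v t)) < ennreal \<epsilon>"
      using Lapp[OF xs(1) ys(1)] by blast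
  qed
  have cl_F: "cl (\<lambda>t. c * indicator U t)" if U: "U \<in> \<F>" for c U
  proof (unfold cl_def, intro conjI allI impI)
    have Um [measurable]: "U \<in> sets borel" using oF[OF U] by simp
    show "(\<lambda>t. c * indicator U t) \<in> borel_measurable borel" by measurable
    fix \<epsilon> :: real assume e: "0 < \<epsilon>"
    obtain K where K: "compact K" "U \<subseteq> K" using kF[OF U] by blast
    define k where "k = enn2real (wint U 0 (\<lambda>_. 1))"
    have k: "wint U 0 (\<lambda>_. 1) = ennreal k" "0 \<le> k"
      using wint_const_finite[OF K(1), of 1] wint_mono_set[OF K(2), of 0 "\<lambda>_. 1"]
      by (auto simp: k_def order_le_less_trans)
    \<comment> \<open>Chosen so that \<open>r powr p * (k + 1) = \<epsilon>\<close>; the added 1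
      covers sets \<open>U\<close> of mass 0.\<close>
    define r where "r = (\<epsilon> / (k + 1)) powr (1 / p)"
    have r: "0 < r" "r powr p = \<epsilon> / (k + 1)" using e k p0 by (auto simp: r_def powr_powr)
    have "ball c r \<noteq> {}" using r(1) by simp
    then obtain c' where c': "c' \<in> C" "dist c c' < r"
      using C(2)[OF open_ball] by auto
    have "wint UNIV 0 (\<lambda>t. step_comb [(c', U)] t - c * indicator U t)
      = wint UNIV 0 (\<lambda>t. (c' - c) * indicator U t)"
      by (simp add: algebra_simps)
    also have "\<dots> = wint U 0 (\<lambda>t. (c' - c) * indicator U t)"
      by (intro wint_restrict) auto
    also have "\<dots> = wint U 0 (\<lambda>t. (c' - c) * 1)" by (intro wint_cong) auto
    also have "\<dots> = ennreal (norm (c' - c) powr p * k)"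
      by (subst wint_cmult) (auto simp: k ennreal_mult'[symmetric])
    also have "\<dots> < ennreal \<epsilon>"
    proof (rule ennreal_lessI[OF e])
      have "norm (c' - c) powr p * k \<le> r powr p * k"
        using c'(2) k p0 by (intro mult_right_mono powr_mono2) (auto simp: dist_norm norm_minus_commute)
      also have "\<dots> < r powr p * (k + 1)" using r(1) by simp
      also have "\<dots> = \<epsilon>" using k by (simp add: r(2))
      finally show "norm (c' - c) powr p * k < \<epsilon>" .
    qed
    finally show "\<exists>xs\<in>L. wint UNIV 0 (\<lambda>t. step_comb xs t - c * indicator U t) < ennreal \<epsilon>"
      using c'(1) U by (intro bexI[of _ "[(c', U)]"]) (auto simp: L_def)
  qed
  have cl_open: "cl (\<lambda>t. c * indicator G t)" if G: "open G" and K: "compact K" "G \<subseteq> K" for c G K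
  proof -
    have Om [measurable]: "G \<in> sets borel" using G by simp
    obtain A where A: "A \<subseteq> \<B>" "G = \<Union>A" using \<B>(3)[OF G] by blast
    have cA: "countable A" using A(1) \<B>(1) countable_subset by blast
    have AU: "A \<subseteq> \<U>" using A K unfolding \<U>_def by blast
    show ?thesis
    proof (cases "A = {}")
      case True
      then show ?thesis using A(2) cl_0 by simp
    next
      case False
      define U where "U n = (\<Union>i\<le>n. from_nat_into A i)" for n
      have UF: "U n \<in> \<F>" for n
        unfolding U_def \<F>_def using AU from_nat_into[OF False]
          by (intro image_eqI[of _ _ "from_nat_into A ` {..n}"]) auto
      have UO: "U n \<subseteq> G" for n using from_nat_into[OF False] A(2) by (auto simp: U_def)
      have Uinc: "incseq U" unfolding U_def incseq_def by (meson UN_mono atMost_subset_iff order_refl)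
      have Uun: "G \<subseteq> (\<Union>n. U n)"
      proof
        fix x assume "x \<in> G"
        then obtain a where a: "a \<in> A" "x \<in> a" using A(2) by blast
        obtain i where "from_nat_into A i = a" using from_nat_into_surj[OF cA a(1)] ..
        then show "x \<in> (\<Union>n. U n)" using a(2) unfolding U_def by auto
      qed
      have Um: "U n \<in> sets borel" for n using oF[OF UF] by simp
      have fin: "wint UNIV 0 (\<lambda>t. c * indicator G t) < \<infinity>"
      proof -
        have "wint UNIV 0 (\<lambda>t. c * indicator G t) = wint G 0 (\<lambda>t. c * indicator G t)"
          by (intro wint_restrict) auto
        also have "\<dots> = wint G 0 (\<lambda>_. c)" by (intro wint_cong) auto
        also have "\<dots> \<le> wint K 0 (\<lambda>_. c)" using K by (intro wint_mono_set)
        finally show ?thesis using wint_const_finite[OF K(1)] by (rule order_le_less_trans)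
      qed
      \<comment> \<open>Adding the complement of \<open>G\<close> turns the exhaustion of
        \<open>G\<close> into one of the whole group, as \<open>wint_exhaust\<close> requires; the
        complements are then the differences \<open>G - U n\<close>.\<close>
      have "(\<lambda>n. wint (- (U n \<union> - G)) 0 (\<lambda>t. c * indicator G t)) \<longlonglongrightarrow> 0"
      proof (rule wint_exhaust)
        show "incseq (\<lambda>n. U n \<union> - G)" using Uinc unfolding incseq_def by blast
        show "(\<Union>n. U n \<union> - G) = UNIV" using Uun by blast
      qed (use Um Om fin in auto)
      moreover have "wint (- (U n \<union> - G)) 0 (\<lambda>t. c * indicator G t) =
        wint UNIV 0 (\<lambda>t. c * indicator (U n) t - c * indicator G t)" for n
      proof -
        have "wint (- (U n \<union> - G)) 0 (\<lambda>t. c * indicator G t) = wint (G - U n) 0 (\<lambda>t. c * indicator G t)"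
          by (simp add: Diff_eq Int_commute)
        also have "\<dots> = wint (G - U n) 0 (\<lambda>_. c)" by (intro wint_cong) auto
        also have "\<dots> = wint UNIV 0 (\<lambda>t. c * indicator G t - c * indicator (U n) t)"
          using wint_indicator_diff[OF UO] by simp
        finally show ?thesis by (simp only: wint_swap)
      qed
      ultimately have "(\<lambda>n. wint UNIV 0 (\<lambda>t. c * indicator (U n) t - c * indicator G t)) \<longlonglongrightarrow> 0" by simp
      then show ?thesis by (rule cl_seq[OF _ cl_F[OF UF], rotated]) measurable
    qed
  qed
  \<comment> \<open>Outer regularity gives an open \<open>G\<close> around \<open>E\<close> of
    nearly the same measure. Intersecting with \<open>V\<close> keeps it inside the compact set
    \<open>K'\<close>, where the weight is bounded and small measure means small
    \<open>wint\<close>.\<close>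
  have cl_borel: "cl (\<lambda>t. c * indicator E t)" if E: "E \<in> sets borel" and K: "compact K" "E \<subseteq> K"
    for c E K
  proof (rule cl_lim)
    show "(\<lambda>t. c * indicator E t) \<in> borel_measurable borel" using E by measurable
    fix \<epsilon> :: real assume e: "0 < \<epsilon>"
    obtain V K' where V: "open V" "compact K'" "K \<subseteq> V" "V \<subseteq> K'"
      using relatively_compact_neighbourhood[OF K(1)] by blast
    obtain B where B: "0 < B" "\<And>t. t \<in> K' \<Longrightarrow> \<omega> t \<le> B" using weight_le_on_compact[OF V(2)] by blast
    define \<delta> where "\<delta> = \<epsilon> / (norm c powr p * B powr p + 1)"
    have den: "0 < norm c powr p * B powr p + 1" by (simp add: add_nonneg_pos)
    then have \<delta>: "0 < \<delta>" using e by (simp add: \<delta>_def)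
    have Efin: "emeasure \<mu> E < \<infinity>"
      using emeasure_mono[OF K(2), of \<mu>] emeasure_compact[OF K(1)] sets_compact[OF K(1)] sets_eq
        by (auto simp: order_le_less_trans)
    obtain m where em: "emeasure \<mu> E = ennreal m" "0 \<le> m"
      using Efin by (cases "emeasure \<mu> E") auto
    have "emeasure \<mu> E < emeasure \<mu> E + ennreal \<delta>" using \<delta> em
      by (simp add: ennreal_plus[symmetric] ennreal_less_iff del: ennreal_plus)
    moreover have "emeasure \<mu> E = (INF U\<in>{U. open U \<and> E \<subseteq> U}. emeasure \<mu> U)"
      using haar E unfolding left_haar_measure_def by blast
    ultimately obtain G where G: "open G" "E \<subseteq> G" "emeasure \<mu> G < emeasure \<mu> E + ennreal \<delta>"
      unfolding INF_less_iff by (metis (no_types, lifting) INF_less_iff mem_Collect_eq)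
    let ?G = "G \<inter> V"
    have OV: "open ?G" "E \<subseteq> ?G" "?G \<subseteq> K'" using G V K by auto
    have Om: "?G \<in> sets borel" "?G \<in> sets \<mu>" "G \<in> sets \<mu>" "E \<in> sets \<mu>" using OV(1) G(1) E sets_eq
      by auto
    have "emeasure \<mu> (?G - E) = emeasure \<mu> ?G - emeasure \<mu> E"
      using Efin OV(2) Om by (intro emeasure_Diff) auto
    also have "\<dots> \<le> emeasure \<mu> G - emeasure \<mu> E"
      using Om by (intro ennreal_minus_mono emeasure_mono) auto
    also have "\<dots> \<le> ennreal \<delta>" using G(3) em(1)
      by (auto simp: ennreal_minus_le_iff less_imp_le)
    finally have m: "emeasure \<mu> (?G - E) \<le> ennreal \<delta>" .
    have "wint UNIV 0 (\<lambda>t. c * indicator ?G t - c * indicator E t) = wint (?G - E) 0 (\<lambda>_. c)"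
      by (rule wint_indicator_diff[OF OV(2)])
    also have "\<dots> \<le> ennreal (norm c powr p * B powr p) * emeasure \<mu> (?G - E)"
      using B(2) OV(3) Om(1) E by (intro wint_const_le_emeasure) auto
    also have "\<dots> \<le> ennreal (norm c powr p * B powr p) * ennreal \<delta>" by (intro mult_left_mono m) auto
    also have "\<dots> = ennreal (norm c powr p * B powr p * \<delta>)" by (simp add: ennreal_mult'[symmetric])
    also have "\<dots> < ennreal \<epsilon>"
    proof (rule ennreal_lessI[OF e])
      have "norm c powr p * B powr p * \<delta>
        = \<epsilon> * (norm c powr p * B powr p) / (norm c powr p * B powr p + 1)"
        by (simp add: \<delta>_def)
      also have "\<dots> < \<epsilon>" using e den by (simp add: field_simps)
      finally show "norm c powr p * B powr p * \<delta> < \<epsilon>" .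
    qed
    finally show "\<exists>v. cl v \<and> wint UNIV 0 (\<lambda>t. v t - c * indicator E t) < ennreal \<epsilon>"
      using cl_open[OF OV(1) V(2) OV(3), of c] by (intro exI[of _ "\<lambda>t. c * indicator ?G t"] conjI)
  qed
  have cl_sum: "cl (\<lambda>t. \<Sum>y\<in>Y. u y t)" if "finite Y" "\<And>y. cl (u y)" for Y
    and u :: "complex \<Rightarrow> 'a \<Rightarrow> complex"
    using that by (induction Y rule: finite_induct) (auto intro: cl_0 cl_add)
  have cl_Lp: "cl u" if u: "u \<in> weighted_Lp \<mu> p \<omega>" for u
  proof -
    have um [measurable]: "u \<in> borel_measurable borel" and ufin: "wint UNIV 0 u < \<infinity>" using u
      by (auto simp: weighted_Lp_iff)
    obtain s where s: "\<And>i. simple_function borel (s i)" "\<And>x. (\<lambda>i. s i x) \<longlonglongrightarrow> u x"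
      "\<And>i x. norm (s i x) \<le> 2 * norm (u x)"
      using borel_measurable_implies_sequence_metric[OF um, of 0] by (auto simp: dist_norm)
    have [measurable]: "s i \<in> borel_measurable borel" for i using s(1)
      by (rule borel_measurable_simple_function)
    obtain K :: "nat \<Rightarrow> 'a set" where K: "\<And>n. compact (K n)" "incseq K" "(\<Union>n. K n) = UNIV"
      using compact_exhaustion[OF lc] by blast
    have [measurable]: "K n \<in> sets borel" for n by (rule sets_compact[OF K(1)])
    \<comment> \<open>Truncation to \<open>K i\<close> makes each level set relatively compact, so
      \<open>cl_borel\<close> applies to it.\<close>
    define v where "v i t = s i t * indicator (K i) t" for i t
    have [measurable]: "v i \<in> borel_measurable borel" for i unfolding v_def by measurable
    have clv: "cl (v i)" for i
    proof -
      have "v i t = (\<Sum>y\<in>s i ` UNIV. y * indicator (s i -` {y} \<inter> K i) t)" for t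
      proof -
        have "(\<Sum>y\<in>s i ` UNIV. y * indicator (s i -` {y} \<inter> K i) t)
          = (\<Sum>y\<in>s i ` UNIV. if s i t = y then y * indicator (K i) t else 0)"
          by (intro sum.cong) (auto simp: indicator_def)
        also have "\<dots> = v i t" using s(1) by (simp add: v_def simple_function_def)
        finally show ?thesis ..
      qed
      moreover have "cl (\<lambda>t. \<Sum>y\<in>s i ` UNIV. y * indicator (s i -` {y} \<inter> K i) t)"
      proof (rule cl_sum)
        show "finite (range (s i))" using s(1) by (simp add: simple_function_def)
        have "s i -` {y} \<inter> K i \<in> sets borel" for y
          using measurable_sets[of "s i" borel borel "{y}"] by auto
        then show "cl (\<lambda>t. y * indicator (s i -` {y} \<inter> K i) t)" for y
          using K(1) by (rule cl_borel) auto
      qed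
      ultimately show ?thesis by presburger
    qed
    have "(\<lambda>i. wint UNIV 0 (\<lambda>t. v i t - u t)) \<longlonglongrightarrow> (\<integral>\<^sup>+t. 0 \<partial>\<mu>)"
      unfolding wint_def
    proof (rule nn_integral_dominated_convergence[where w =
      \<comment> \<open>The simple functions satisfy
        \<open>norm (s i t) \<le> 2 * norm (u t)\<close>, so the difference from \<open>u\<close> is
        at most three times \<open>norm (u t)\<close>.\<close>
      "\<lambda>t. ennreal (3 powr p) * (ennreal (norm (u t) powr p * \<omega> (0 + t) powr p) * indicator UNIV t)"])
      show "(\<integral>\<^sup>+t. ennreal (3 powr p)
        * (ennreal (norm (u t) powr p * \<omega> (0 + t) powr p) * indicator UNIV t) \<partial>\<mu>) < \<infinity>"
        using ufin by (subst nn_integral_cmult) (auto simp: wint_def ennreal_mult_less_top)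
      show "AE t in \<mu>. ennreal (norm (v i t - u t) powr p * \<omega> (0 + t) powr p) * indicator UNIV t
          \<le> ennreal (3 powr p) *
          (ennreal (norm (u t) powr p * \<omega> (0 + t) powr p) * indicator UNIV t)" for i
      proof (rule AE_I2)
        fix t
        have "norm (v i t - u t) \<le> norm (v i t) + norm (u t)" by (rule norm_triangle_ineq4)
        also have "\<dots> \<le> 3 * norm (u t)" using s(3)[of i t] by (auto simp: v_def indicator_def)
        finally have "norm (v i t - u t) powr p \<le> (3 * norm (u t)) powr p" using p0
          by (intro powr_mono2) auto
        then have "norm (v i t - u t) powr p * \<omega> t powr p \<le> 3 powr p * norm (u t) powr p * \<omega> t powr p"
          by (intro mult_right_mono) (simp_all add: powr_mult)
        then show "ennreal (norm (v i t - u t) powr p * \<omega> (0 + t) powr p) * indicator UNIV t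
          \<le> ennreal (3 powr p) * (ennreal (norm (u t) powr p * \<omega> (0 + t) powr p) * indicator UNIV t)"
          by (simp add: ennreal_mult'[symmetric] ennreal_leI mult.assoc)
      qed
      show "AE t in \<mu>. (\<lambda>i. ennreal (norm (v i t - u t) powr p * \<omega> (0 + t) powr p) * indicator UNIV t)
        \<longlonglongrightarrow> 0"
      proof (rule AE_I2)
        fix t
        obtain N where "t \<in> K N" using K(3) by blast
        then have "t \<in> K n" if "n \<ge> N" for n using that K(2) unfolding incseq_def by blast
        then have "eventually (\<lambda>i. v i t = s i t) sequentially"
          unfolding eventually_sequentially v_def by (intro exI[of _ N]) auto
        then have "(\<lambda>i. v i t) \<longlonglongrightarrow> u t" by (rule tendsto_cong[THEN iffD2, OF _ s(2)])
        then have "(\<lambda>i. norm (v i t - u t)) \<longlonglongrightarrow> 0" by (simp add: LIM_zero_iff tendsto_norm_zero)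
        then have "(\<lambda>i. norm (v i t - u t) powr p) \<longlonglongrightarrow> 0 powr p"
          using p0 by (intro tendsto_powr') auto
        then have "(\<lambda>i. ennreal (norm (v i t - u t) powr p * \<omega> t powr p)) \<longlonglongrightarrow> ennreal
          (0 powr p * \<omega> t powr p)"
          by (intro tendsto_ennrealI tendsto_mult tendsto_const)
        then show "(\<lambda>i. ennreal (norm (v i t - u t) powr p * \<omega> (0 + t) powr p) * indicator UNIV t) \<longlonglongrightarrow>
          0" by simp
      qed
    qed measurable
    then show ?thesis using clv um by (intro cl_seq[of u v]) auto
  qed
  show ?thesis
  proof (rule that[of D])
    show "countable D" unfolding D_def L_def using C(1) cF
      by (intro countable_image countable_lists countable_SIGMA)
    show "D \<noteq> {}" unfolding D_def L_def by (auto intro: exI[of _ "[]"])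
    show "d \<in> borel_measurable borel" if "d \<in> D" for d using that Lm by (auto simp: D_def)
    show "\<exists>K B. compact K \<and> (\<forall>t. norm (d t) \<le> B) \<and> (\<forall>t. t \<notin> K \<longrightarrow> d t = 0)" if "d \<in> D" for d
    proof -
      have "\<exists>K B. compact K \<and> (\<forall>t. norm (step_comb xs t) \<le> B) \<and> (\<forall>t. t \<notin> K \<longrightarrow> step_comb xs t = 0)"
        if "xs \<in> L" for xs
        using that
      proof (induction xs)
        case Nil
        show ?case by (intro exI[of _ "{}"] exI[of _ 0]) auto
      next
        case (Cons x xs)
        obtain c U where x: "x = (c, U)" by force
        have "U \<in> \<F>" "xs \<in> L" using Cons.prems by (auto simp: L_def x)
        obtain K where K: "compact K" "U \<subseteq> K" using kF[OF \<open>U \<in> \<F>\<close>] by blast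
        obtain K' B where K': "compact K'" "\<And>t. norm (step_comb xs t) \<le> B"
          "\<And>t. t \<notin> K' \<Longrightarrow> step_comb xs t = 0"
          using Cons.IH[OF \<open>xs \<in> L\<close>] by blast
        show ?case
        proof (intro exI[of _ "K \<union> K'"] exI[of _ "norm c + B"] conjI allI impI)
          show "compact (K \<union> K')" using K K' by (intro compact_Un)
          show "norm (step_comb (x # xs) t) \<le> norm c + B" for t
          proof -
            have "norm (step_comb (x # xs) t) \<le> norm (c * indicator U t) + norm (step_comb xs t)"
              unfolding x step_comb_simps by (rule norm_triangle_ineq)
            also have "norm (c * indicator U t) \<le> norm c" by (auto simp: indicator_def)
            finally show ?thesis using K'(2)[of t] by simp
          qed
          show "step_comb (x # xs) t = 0" if "t \<notin> K \<union> K'" for t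
            using that K(2) K'(3)[of t] by (auto simp: x indicator_def)
        qed
      qed
      then show ?thesis using that by (auto simp: D_def)
    qed
    show "\<exists>d\<in>D. wint UNIV 0 (\<lambda>t. d t - u t) < ennreal \<epsilon>" if "u \<in> weighted_Lp \<mu> p \<omega>" "0 < \<epsilon>" for u \<epsilon>
      using cl_Lp[OF that(1)] that(2) unfolding cl_def D_def by blast
  qed
qed

section \<open>Construction of a dense vector\<close>

text \<open>The pointwise bound for weighted series is integrated term by term. Where the weighted
  series is infinite the pointwise bound holds trivially, so it can be integrated over all of
  \<open>E\<close>.\<close>

lemma wint_suminf_le:
  assumes [measurable]: "E \<in> sets borel" "\<And>k. F k \<in> borel_measurable borel"
  shows "wint E s (\<lambda>t. \<Sum>k. F k t)
    \<le> ennreal (2 powr p) * (\<Sum>k. ennreal (2 powr (k * p)) * wint E s (F k))"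
proof -
  let ?x = "\<lambda>k t. ennreal (2 powr (real k * p) * norm (F k t) powr p)"
  let ?w = "\<lambda>t. ennreal (\<omega> (s + t) powr p) * indicator E t"
  have pt: "ennreal (norm (\<Sum>k. F k t) powr p) \<le> ennreal (2 powr p) * (\<Sum>k. ?x k t)" for t
  proof (cases "(\<Sum>k. ?x k t) = \<infinity>")
    case True
    then show ?thesis by (simp add: ennreal_mult_top)
  next
    case False
    then show ?thesis using norm_suminf_powr_le(2)[OF p0, of "\<lambda>k. F k t"] by (simp add: less_top)
  qed
  have term_eq: "(\<integral>\<^sup>+t. ?x k t * ?w t \<partial>\<mu>) = ennreal (2 powr (k * p)) * wint E s (F k)" for k
  proof -
    have "(\<integral>\<^sup>+t. ?x k t * ?w t \<partial>\<mu>) = (\<integral>\<^sup>+t. ennreal (2 powr (k * p)) *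
        (ennreal (norm (F k t) powr p * \<omega> (s + t) powr p) * indicator E t) \<partial>\<mu>)"
      by (intro nn_integral_cong) (simp add: ennreal_mult' mult.assoc)
    also have "\<dots> = ennreal (2 powr (k * p)) * wint E s (F k)"
      unfolding wint_def by (rule nn_integral_cmult) measurable
    finally show ?thesis .
  qed
  have "wint E s (\<lambda>t. \<Sum>k. F k t) = (\<integral>\<^sup>+t. ennreal (norm (\<Sum>k. F k t) powr p) * ?w t \<partial>\<mu>)"
    unfolding wint_def by (intro nn_integral_cong) (simp add: ennreal_mult' mult.assoc)
  also have "\<dots> \<le> (\<integral>\<^sup>+t. (ennreal (2 powr p) * (\<Sum>k. ?x k t)) * ?w t \<partial>\<mu>)"
    by (intro nn_integral_mono mult_right_mono pt) auto
  also have "\<dots> = (\<integral>\<^sup>+t. ennreal (2 powr p) * (\<Sum>k. ?x k t * ?w t) \<partial>\<mu>)"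
    by (simp add: mult.assoc)
  also have "\<dots> = ennreal (2 powr p) * (\<integral>\<^sup>+t. (\<Sum>k. ?x k t * ?w t) \<partial>\<mu>)"
    by (rule nn_integral_cmult) measurable
  also have "(\<integral>\<^sup>+t. (\<Sum>k. ?x k t * ?w t) \<partial>\<mu>) = (\<Sum>k. \<integral>\<^sup>+t. ?x k t * ?w t \<partial>\<mu>)"
    by (rule nn_integral_suminf) measurable
  finally show ?thesis by (simp only: term_eq)
qed

text \<open>A finite integral of the weighted sum makes that sum finite almost everywhere. The
  positive factor \<open>\<omega> t powr p\<close> cancels, and pointwise finiteness implies
  summability.\<close>

lemma AE_summable:
  fixes F :: "nat \<Rightarrow> 'a \<Rightarrow> complex"
  assumes [measurable]: "\<And>k. F k \<in> borel_measurable borel"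
    and fin: "(\<Sum>k. ennreal (2 powr (k * p)) * wint UNIV 0 (F k)) < \<infinity>"
  shows "AE t in \<mu>. summable (\<lambda>k. F k t)"
proof -
  let ?y = "\<lambda>k t. ennreal (2 powr (real k * p))
  * (ennreal (norm (F k t) powr p * \<omega> (0 + t) powr p) * indicator UNIV t)"
  have "(\<integral>\<^sup>+t. (\<Sum>k. ?y k t) \<partial>\<mu>) = (\<Sum>k. \<integral>\<^sup>+t. ?y k t \<partial>\<mu>)" by (rule nn_integral_suminf) measurable
  also have "\<dots> = (\<Sum>k. ennreal (2 powr (k * p)) * wint UNIV 0 (F k))"
    unfolding wint_def by (intro suminf_cong nn_integral_cmult) measurable
  finally have "(\<integral>\<^sup>+t. (\<Sum>k. ?y k t) \<partial>\<mu>) \<noteq> \<infinity>" using fin by auto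
  then have "AE t in \<mu>. (\<Sum>k. ?y k t) \<noteq> \<infinity>"
    by (intro nn_integral_PInf_AE) measurable
  then show ?thesis
  proof eventually_elim
    case (elim t)
    have w: "0 < \<omega> t powr p" using pos[of t] by simp
    have "(\<Sum>k. ?y k t) = (\<Sum>k. ennreal (2 powr (real k * p) * norm (F k t) powr p)
      * ennreal (\<omega> t powr p))"
      by (simp add: ennreal_mult' mult.assoc)
    also have "\<dots> = (\<Sum>k. ennreal (2 powr (real k * p) * norm (F k t) powr p)) * ennreal (\<omega> t powr p)"
      by (rule ennreal_suminf_multc)
    finally have "(\<Sum>k. ennreal (2 powr (real k * p) * norm (F k t) powr p)) \<noteq> \<infinity>"
      using elim w by (auto simp: ennreal_top_mult)
    then show ?case using norm_suminf_powr_le(1)[OF p0, of "\<lambda>k. F k t"] by (simp add: less_top)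
  qed
qed

text \<open>The support of the translate lies in the compact set \<open>- x + K\<close>, where the
  right quotient bound gives \<open>\<omega> (s + t) \<le> C * \<omega> s\<close>. Thus
  \<open>\<omega> s\<close> alone controls the dependence on \<open>s\<close>, with a constant
  depending only on \<open>g\<close> and \<open>x\<close>.\<close>

lemma wint_translate_compact_support:
  assumes g [measurable]: "g \<in> borel_measurable borel" and K: "compact K" "\<And>t. t \<notin> K \<Longrightarrow> g t = 0"
    and B: "\<And>t. norm (g t) \<le> B"
  obtains C where "0 < C" "\<And>s. wint UNIV s (\<lambda>t. g (x + t)) \<le> ennreal (C * \<omega> s powr p)"
proof -
  define K' where "K' = (+) (- x) ` K"
  have K': "compact K'" unfolding K'_def
    by (intro compact_continuous_image K continuous_on_add continuous_on_const continuous_on_id)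
  obtain C where C: "0 < C" "\<And>s t. s \<in> K' \<Longrightarrow> \<omega> (t + s) \<le> C * \<omega> t" using right_bound[OF K'] by blast
  define m where "m = enn2real (emeasure \<mu> K')"
  have m: "emeasure \<mu> K' = ennreal m" "0 \<le> m" using emeasure_compact[OF K'] by (auto simp: m_def)
  have B0: "0 \<le> B" using B[of x] norm_ge_zero order_trans by blast
  show ?thesis
  proof
    show "0 < (B * C) powr p * m + 1" using m by (simp add: add_nonneg_pos)
    fix s
    have "wint UNIV s (\<lambda>t. g (x + t)) = wint K' s (\<lambda>t. g (x + t))"
    proof (rule wint_restrict)
      fix t assume t: "t \<in> UNIV - K'"
      have "x + t \<notin> K"
      proof
        assume "x + t \<in> K"
        moreover have "t = - x + (x + t)" by (simp add: add.assoc[symmetric])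
        ultimately show False using t unfolding K'_def by blast
      qed
      then show "g (x + t) = 0" by (rule K)
    qed simp
    also have "\<dots> \<le> (\<integral>\<^sup>+t. ennreal ((B * C) powr p * \<omega> s powr p) * indicator K' t \<partial>\<mu>)"
      unfolding wint_def
    proof (rule nn_integral_mono)
      fix t
      show "ennreal (norm (g (x + t)) powr p * \<omega> (s + t) powr p) * indicator K' t
        \<le> ennreal ((B * C) powr p * \<omega> s powr p) * indicator K' t"
      proof (cases "t \<in> K'")
        case True
        have "norm (g (x + t)) powr p * \<omega> (s + t) powr p \<le> B powr p * (C * \<omega> s) powr p"
          using B C(2)[OF True, of s] p0
            by (intro mult_mono powr_mono2) (auto simp: less_imp_le[OF pos])
        also have "\<dots> = (B * C) powr p * \<omega> s powr p" by (simp add: powr_mult)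
        finally show ?thesis by (auto simp: indicator_def intro: ennreal_leI)
      qed simp
    qed
    also have "\<dots> = ennreal ((B * C) powr p * \<omega> s powr p) * ennreal m"
      using sets_compact[OF K'] by (subst nn_integral_cmult_indicator) (auto simp: m sets_eq)
    also have "\<dots> = ennreal ((B * C) powr p * m * \<omega> s powr p)" using m
      by (simp add: ennreal_mult'[symmetric] mult_ac)
    also have "\<dots> \<le> ennreal (((B * C) powr p * m + 1) * \<omega> s powr p)"
      by (intro ennreal_leI mult_right_mono) auto
    finally show "wint UNIV s (\<lambda>t. g (x + t)) \<le> ennreal (((B * C) powr p * m + 1) * \<omega> s powr p)" .
  qed
qed

lemma wint_translate_fun:
  assumes [measurable]: "g \<in> borel_measurable borel"
  shows "wint UNIV 0 (\<lambda>t. g (x + t)) = wint UNIV (- x) g"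
  using wint_translate[of UNIV "\<lambda>t. g (x + t)" "- x"] by (simp add: add.assoc[symmetric])

text \<open>In \<open>c\<^sub>n T f\<close> with translation by \<open>s\<^sub>n\<close>, the
  \<open>n\<close>-th summand of \<open>f\<close> returns \<open>g n\<close>. Earlier summands are
  small because \<open>norm (c n) * \<omega> (s n)\<close> is, later ones because
  \<open>\<omega> (- s k) / norm (c k)\<close> was chosen small after \<open>s n\<close> and
  \<open>c n\<close> were known.\<close>

lemma dense_vector_sufficient:
  assumes ex: "\<And>\<epsilon>. 0 < \<epsilon> \<Longrightarrow> \<exists>s\<in>S. \<exists>c\<in>\<Lambda>. norm c * \<omega> s < \<epsilon> \<and> \<omega> (- s) < \<epsilon> * norm c"
  shows "\<exists>f. dense_vector \<mu> p \<omega> \<Lambda> S f"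
proof -
  obtain D :: "('a \<Rightarrow> complex) set" where D: "countable D" "D \<noteq> {}"
    "\<And>d. d \<in> D \<Longrightarrow> d \<in> borel_measurable borel"
    "\<And>d. d \<in> D \<Longrightarrow> \<exists>K B. compact K \<and> (\<forall>t. norm (d t) \<le> B) \<and> (\<forall>t. t \<notin> K \<longrightarrow> d t = 0)"
    "\<And>u \<epsilon>. u \<in> weighted_Lp \<mu> p \<omega> \<Longrightarrow> 0 < \<epsilon> \<Longrightarrow> \<exists>d\<in>D. wint UNIV 0 (\<lambda>t. d t - u t) < ennreal \<epsilon>"
    using countable_dense_step_combs by blast
  \<comment> \<open>The first component selects a member of \<open>D\<close>; the second is ignored,
    so each member recurs infinitely often.\<close>
  define g where "g n = from_nat_into D (fst (prod_decode n))" for n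
  have gD: "g n \<in> D" for n unfolding g_def by (rule from_nat_into[OF D(2)])
  have gm [measurable]: "g n \<in> borel_measurable borel" for n by (rule D(3)[OF gD])
  have g_inf: "\<exists>n\<ge>N. g n = d" if d: "d \<in> D" for d N
  proof -
    obtain i where "from_nat_into D i = d" using from_nat_into_surj[OF D(1) d] ..
    then have "g (prod_encode (i, N)) = d" by (simp add: g_def)
    then show ?thesis using le_prod_encode_2 by blast
  qed

  have "\<exists>C>0. \<forall>s. wint UNIV s (\<lambda>t. g n (x + t)) \<le> ennreal (C * \<omega> s powr p)" for n x
  proof -
    obtain K B where KB: "compact K" "\<And>t. norm (g n t) \<le> B" "\<And>t. t \<notin> K \<Longrightarrow> g n t = 0"
      using D(4)[OF gD[of n]] by auto
    show ?thesis by (rule wint_translate_compact_support[OF gm KB(1) KB(3) KB(2), of x]) auto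
  qed
  then obtain C where C: "\<And>n x. 0 < C n x"
    "\<And>n x s. wint UNIV s (\<lambda>t. g n (x + t)) \<le> ennreal (C n x * \<omega> s powr p)" by metis
  have "\<exists>M>0. \<forall>t. \<omega> (s + t) \<le> M * \<omega> t" for s
    using left_bound[of "{s}"] by (metis compact_sing singletonI)
  then obtain M where M: "\<And>s. 0 < M s" "\<And>s t. \<omega> (s + t) \<le> M s * \<omega> t" by metis

  \<comment> \<open>The part \<open>- real n * p\<close> pays for the weights
    \<open>2 powr (k * p)\<close>; the part \<open>- 2 * real n\<close> is spent through
    \<open>2 * max k n \<ge> k + n\<close>, giving geometric decay in both indices.\<close>
  define w where "w n = 2 powr (- (real n * p) - 2 * real n)" for n
  have w0: "0 < w n" for n by (simp add: w_def)
  \<comment> \<open>The three bounds control, in turn, the size of the new summand, the images of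
    the earlier summands under the new operator, and the images of the new summand under the earlier
    operators.\<close>
  define P where "P f n r \<longleftrightarrow> (case r of (s, c) \<Rightarrow> s \<in> S \<and> c \<in> \<Lambda> \<and> c \<noteq> 0 \<and>
      C n 0 * (\<omega> (- s) / norm c) powr p \<le> w n \<and>
      (\<forall>k<n. C k (fst (f k)) / norm (snd (f k)) powr p * (norm c * \<omega> s) powr p \<le> w n) \<and>
      (\<forall>k<n. norm (snd (f k)) powr p * M (fst (f k)) powr p * C n 0 * (\<omega> (- s) / norm c) powr p \<le> w n))"
    for f :: "nat \<Rightarrow> 'a \<times> complex" and n r
  have "\<exists>f. \<forall>n. P f n (f n)"
  proof (rule dependent_wellorder_choice)
    show "P f n r = P g n r" if "\<And>k. k < n \<Longrightarrow> f k = g k" for f g n r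
      using that by (auto simp: P_def)
    fix n :: nat and f :: "nat \<Rightarrow> 'a \<times> complex"
    \<comment> \<open>\<open>A\<close> dominates every coefficient in the finitely many bounds, so
      one \<epsilon> with \<open>A * \<epsilon> powr p = w n\<close> meets them all.\<close>
    define A where "A = C n 0 + (\<Sum>k<n. C k (fst (f k)) / norm (snd (f k)) powr p)
      + (\<Sum>k<n. norm (snd (f k)) powr p * M (fst (f k)) powr p * C n 0)"
    have nn: "0 \<le> C k (fst (f k)) / norm (snd (f k)) powr p"
      "0 \<le> norm (snd (f k)) powr p * M (fst (f k)) powr p * C n 0" for k
      by (simp_all add: less_imp_le[OF C(1)])
    have s0: "0 \<le> (\<Sum>k<n. C k (fst (f k)) / norm (snd (f k)) powr p)"
      "0 \<le> (\<Sum>k<n. norm (snd (f k)) powr p * M (fst (f k)) powr p * C n 0)"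
      using nn by (auto intro!: sum_nonneg)
    have A: "0 < A" "C n 0 \<le> A" unfolding A_def using C(1)[of n 0] s0 by linarith+
    have A1: "C k (fst (f k)) / norm (snd (f k)) powr p \<le> A" if "k < n" for k
      using member_le_sum[of k "{..<n}" "\<lambda>k. C k (fst (f k)) / norm (snd (f k)) powr p"] nn that s0
        C(1)[of n 0]
      unfolding A_def by auto
    have A2: "norm (snd (f k)) powr p * M (fst (f k)) powr p * C n 0 \<le> A" if "k < n" for k
      using member_le_sum[of k "{..<n}" "\<lambda>k. norm (snd (f k)) powr p * M (fst (f k)) powr p * C n 0"]
        nn that s0 C(1)[of n 0]
      unfolding A_def by auto
    define \<epsilon> where "\<epsilon> = (w n / A) powr (1 / p)"
    have \<epsilon>: "0 < \<epsilon>" using A(1) w0[of n] by (simp add: \<epsilon>_def)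
    have small: "a * x powr p \<le> w n" if "0 \<le> x" "x \<le> \<epsilon>" "a \<le> A" for a x
    proof -
      have "a * x powr p \<le> A * \<epsilon> powr p" using that p0 A(1) by (intro mult_mono powr_mono2) auto
      also have "\<dots> = w n" using A(1) w0[of n] p0 by (simp add: \<epsilon>_def powr_powr)
      finally show ?thesis .
    qed
    obtain s c where sc: "s \<in> S" "c \<in> \<Lambda>" "norm c * \<omega> s < \<epsilon>" "\<omega> (- s) < \<epsilon> * norm c"
      using ex[OF \<epsilon>] by blast
    have c0: "c \<noteq> 0" using sc(4) pos[of "- s"] by auto
    have "\<omega> (- s) / norm c \<le> \<epsilon>" "0 \<le> \<omega> (- s) / norm c" using sc(4) c0 less_imp_le[OF pos]
      by (auto simp: field_simps)
    moreover have "norm c * \<omega> s \<le> \<epsilon>" "0 \<le> norm c * \<omega> s" using sc(3) less_imp_le[OF pos] by auto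
    ultimately have "P f n (s, c)"
      unfolding P_def prod.case using sc(1,2) c0 by (intro conjI allI impI small A(2) A1 A2)
    then show "\<exists>r. P f n r" by blast
  qed
  then obtain r where r: "\<And>n. P r n (r n)" by blast
  define s where "s n = fst (r n)" for n
  define c where "c n = snd (r n)" for n
  have sc: "s n \<in> S" "c n \<in> \<Lambda>" "c n \<noteq> 0" for n using r[of n] by (auto simp: P_def s_def c_def)
  have b1: "C n 0 * (\<omega> (- s n) / norm (c n)) powr p \<le> w n" for n
    using r[of n] by (auto simp: P_def s_def c_def)
  have b2: "C k (s k) / norm (c k) powr p * (norm (c n) * \<omega> (s n)) powr p \<le> w n" if "k < n" for k n
    using r[of n] that by (auto simp: P_def s_def c_def)
  have b3: "norm (c n) powr p * M (s n) powr p * C k 0 * (\<omega> (- s k) / norm (c k)) powr p \<le> w k"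
    if "n < k" for k n
    using r[of k] that by (auto simp: P_def s_def c_def)

  define F where "F k t = (1 / c k) * g k (s k + t)" for k t
  have [measurable]: "F k \<in> borel_measurable borel" for k unfolding F_def by measurable
  have F: "wint UNIV x (F k) = ennreal (1 / norm (c k) powr p) * wint UNIV x (\<lambda>t. g k (s k + t))"
    for k x
    unfolding F_def by (subst wint_cmult) (auto simp: norm_divide powr_divide)
  have F_le: "wint UNIV x (F k) \<le> ennreal (C k (s k) / norm (c k) powr p * \<omega> x powr p)" for k x
  proof -
    have "wint UNIV x (F k) \<le> ennreal (1 / norm (c k) powr p) * ennreal (C k (s k) * \<omega> x powr p)"
      unfolding F by (intro mult_left_mono C) auto
    also have "\<dots> = ennreal (C k (s k) / norm (c k) powr p * \<omega> x powr p)"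
      by (simp add: ennreal_mult'[symmetric])
    finally show ?thesis .
  qed
  have F0: "wint UNIV 0 (F k) \<le> ennreal (C k 0 * (\<omega> (- s k) / norm (c k)) powr p)" for k
  proof -
    have "wint UNIV 0 (F k) = ennreal (1 / norm (c k) powr p) * wint UNIV (- s k) (\<lambda>t. g k (0 + t))"
      unfolding F by (simp add: wint_translate_fun)
    also have "\<dots> \<le> ennreal (1 / norm (c k) powr p) * ennreal (C k 0 * \<omega> (- s k) powr p)"
      by (intro mult_left_mono C) auto
    also have "\<dots> = ennreal (C k 0 * (\<omega> (- s k) / norm (c k)) powr p)"
      by (simp add: ennreal_mult'[symmetric] powr_divide less_imp_le[OF pos])
    finally show ?thesis .
  qed
  have F0w: "wint UNIV 0 (F k) \<le> ennreal (w k)" for k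
    using F0[of k] b1[of k] by (meson ennreal_leI order_trans)
  \<comment> \<open>For \<open>k < n\<close> the bound secured at stage \<open>n\<close> applies;
    for \<open>k > n\<close> the operator constant \<open>M (s n)\<close> was already known at stage
    \<open>k\<close>.\<close>
  have off_diag: "ennreal (norm (c n) powr p) * wint UNIV (s n) (F k) \<le> ennreal (w (max k n))"
    if "k \<noteq> n" for k n
  proof (cases "k < n")
    case True
    have "ennreal (norm (c n) powr p) * wint UNIV (s n) (F k)
        \<le> ennreal (norm (c n) powr p) * ennreal (C k (s k) / norm (c k) powr p * \<omega> (s n) powr p)"
      by (intro mult_left_mono F_le) auto
    also have "\<dots> = ennreal (C k (s k) / norm (c k) powr p * (norm (c n) * \<omega> (s n)) powr p)"
      by (simp add: ennreal_mult'[symmetric] powr_mult mult_ac)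
    also have "\<dots> \<le> ennreal (w n)" by (intro ennreal_leI b2 True)
    finally show ?thesis using True by (simp add: max_def)
  next
    case False
    then have kn: "n < k" using that by simp
    have "wint UNIV (s n) (F k) \<le> ennreal (M (s n) powr p) * wint UNIV 0 (F k)"
      by (intro wint_left_le M) auto
    also have "\<dots> \<le> ennreal (M (s n) powr p) * ennreal (C k 0 * (\<omega> (- s k) / norm (c k)) powr p)"
      by (intro mult_left_mono F0) auto
    finally have "ennreal (norm (c n) powr p) * wint UNIV (s n) (F k)
        \<le> ennreal (norm (c n) powr p) *
        (ennreal (M (s n) powr p) * ennreal (C k 0 * (\<omega> (- s k) / norm (c k)) powr p))"
      by (intro mult_left_mono) auto
    also have "\<dots> = ennreal (norm (c n) powr p * M (s n) powr p * C k 0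
      * (\<omega> (- s k) / norm (c k)) powr p)"
      by (simp add: ennreal_mult'[symmetric] mult.assoc)
    also have "\<dots> \<le> ennreal (w k)" by (intro ennreal_leI b3 kn)
    finally show ?thesis using kn by (simp add: max_def)
  qed
  have geo: "(\<Sum>k. ennreal (a * (1 / 2) ^ k)) = ennreal (2 * a)" if "0 \<le> a" for a
  proof -
    have "(\<lambda>k. a * (1 / 2) ^ k) sums (a * (1 / (1 - 1 / 2)))"
      by (intro sums_mult geometric_sums) auto
    then show ?thesis using that by (intro suminf_ennreal_eq) (auto simp: mult.commute)
  qed
  have pow: "(1 / 2) ^ k = 2 powr (- real k)" for k :: nat
    by (simp add: powr_minus powr_realpow power_one_over inverse_eq_divide)

  \<comment> \<open>Where the series diverges, \<open>suminf\<close> is an unspecified value; by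
    \<open>AE_summable\<close> this happens only on a null set.\<close>
  define f where "f t = (\<Sum>k. F k t)" for t
  have fm [measurable]: "f \<in> borel_measurable borel" unfolding f_def by measurable
  have sumF: "(\<Sum>k. ennreal (2 powr (k * p)) * wint UNIV 0 (F k)) \<le> ennreal 2"
  proof -
    have "(\<Sum>k. ennreal (2 powr (k * p)) * wint UNIV 0 (F k)) \<le> (\<Sum>k. ennreal (1 * (1 / 2) ^ k))"
    proof (intro suminf_le allI)
      fix k
      have "ennreal (2 powr (k * p)) * wint UNIV 0 (F k) \<le> ennreal (2 powr (k * p)) * ennreal (w k)"
        by (intro mult_left_mono F0w) auto
      also have "\<dots> = ennreal (2 powr (- 2 * real k))"
        by (simp add: ennreal_mult'[symmetric] w_def powr_add[symmetric])
      also have "\<dots> \<le> ennreal (1 * (1 / 2) ^ k)" unfolding pow by (intro ennreal_leI) simp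
      finally show "ennreal (2 powr (k * p)) * wint UNIV 0 (F k) \<le> ennreal (1 * (1 / 2) ^ k)" .
    qed auto
    also have "\<dots> = ennreal (2 * 1)" by (rule geo) simp
    finally show ?thesis by (simp only: mult_1_right)
  qed
  have sumF_fin: "(\<Sum>k. ennreal (2 powr (k * p)) * wint UNIV 0 (F k)) < \<infinity>"
    using sumF by (simp add: order_le_less_trans)
  have "wint UNIV 0 f \<le> ennreal (2 powr p) * (\<Sum>k. ennreal (2 powr (k * p)) * wint UNIV 0 (F k))"
    unfolding f_def by (rule wint_suminf_le) auto
  also have "\<dots> < \<infinity>" using sumF_fin by (simp add: ennreal_mult_less_top)
  finally have f_fin: "wint UNIV 0 f < \<infinity>" .

  have approx: "wint UNIV (s n) (\<lambda>t. c n * f t - g n (s n + t))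
    \<le> ennreal (2 powr p * 2 * (1 / 2) ^ n)" for n
  proof -
    \<comment> \<open>Off the null set of divergence, removing the diagonal summand subtracts
      exactly \<open>g n (s n + t)\<close>, so the approximation error is the sum of the
      \<open>H k\<close>.\<close>
    define H where "H k t = (if k = n then 0 else c n * F k t)" for k t
    have [measurable]: "H k \<in> borel_measurable borel" for k unfolding H_def by measurable
    have "wint UNIV (s n) (\<lambda>t. c n * f t - g n (s n + t)) = wint UNIV (s n) (\<lambda>t. \<Sum>k. H k t)"
      unfolding wint_def
    proof (rule nn_integral_cong_AE)
      show "AE t in \<mu>. ennreal (norm (c n * f t - g n (s n + t)) powr p * \<omega> (s n + t) powr p)
        * indicator UNIV t =
         ennreal (norm (\<Sum>k. H k t) powr p * \<omega> (s n + t) powr p) * indicator UNIV t"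
        using AE_summable[OF \<open>\<And>k. F k \<in> borel_measurable borel\<close> sumF_fin]
      proof eventually_elim
        case (elim t)
        have "(\<lambda>k. c n * F k t) sums (c n * f t)" unfolding f_def using elim
          by (intro sums_mult summable_sums)
        moreover have "(\<lambda>k. if k = n then c n * F k t else 0) sums (c n * F n t)" by (rule sums_single)
        ultimately have "(\<lambda>k. c n * F k t - (if k = n then c n * F k t else 0)) sums
          (c n * f t - c n * F n t)"
          by (rule sums_diff)
        moreover have "(\<lambda>k. c n * F k t - (if k = n then c n * F k t else 0)) = (\<lambda>k. H k t)"
          by (auto simp: H_def)
        moreover have "c n * F n t = g n (s n + t)" using sc(3)[of n] by (simp add: F_def)
        ultimately have "(\<Sum>k. H k t) = c n * f t - g n (s n + t)" by (simp add: sums_iff)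
        then show ?case by simp
      qed
    qed
    also have "\<dots> \<le> ennreal (2 powr p) * (\<Sum>k. ennreal (2 powr (k * p)) * wint UNIV (s n) (H k))"
      by (rule wint_suminf_le) auto
    also have "(\<Sum>k. ennreal (2 powr (k * p)) * wint UNIV (s n) (H k))
      \<le> (\<Sum>k. ennreal ((1 / 2) ^ n * (1 / 2) ^ k))"
    proof (intro suminf_le allI)
      fix k
      show "ennreal (2 powr (k * p)) * wint UNIV (s n) (H k) \<le> ennreal ((1 / 2) ^ n * (1 / 2) ^ k)"
      proof (cases "k = n")
        case True
        then show ?thesis by (simp add: H_def wint_def)
      next
        case False
        have "wint UNIV (s n) (H k) = wint UNIV (s n) (\<lambda>t. c n * F k t)"
          using False by (intro wint_cong) (simp add: H_def)
        also have "\<dots> = ennreal (norm (c n) powr p) * wint UNIV (s n) (F k)" by (rule wint_cmult) auto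
        also have "\<dots> \<le> ennreal (w (max k n))" by (rule off_diag[OF False])
        finally have "ennreal (2 powr (k * p)) * wint UNIV (s n) (H k)
          \<le> ennreal (2 powr (k * p)) * ennreal (w (max k n))"
          by (intro mult_left_mono) auto
        also have "\<dots> = ennreal (2 powr (real k * p - real (max k n) * p - 2 * real (max k n)))"
          by (simp add: ennreal_mult'[symmetric] w_def powr_add[symmetric] algebra_simps)
        also have "\<dots> \<le> ennreal (2 powr (- real n + - real k))"
        proof (intro ennreal_leI powr_mono)
          have "real k * p \<le> real (max k n) * p" using p0 by (intro mult_right_mono) auto
          then show "real k * p - real (max k n) * p - 2 * real (max k n) \<le> - real n + - real k"
            by linarith
        qed simp
        also have "\<dots> = ennreal ((1 / 2) ^ n * (1 / 2) ^ k)" unfolding pow powr_add ..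
        finally show ?thesis .
      qed
    qed auto
    also have "\<dots> = ennreal (2 * (1 / 2) ^ n)" by (rule geo) simp
    finally show ?thesis by (simp add: ennreal_mult'[symmetric] mult.assoc mult_left_mono)
  qed

  have trans: "wint UNIV 0 (\<lambda>t. c' * left_translation x f t - h t)
    = wint UNIV x (\<lambda>t. c' * f t - h (x + t))"
    if [measurable]: "h \<in> borel_measurable borel" for c' x h
    using wint_translate[of UNIV "\<lambda>t. c' * f (- x + t) - h t" x]
    by (simp add: left_translation_def add.assoc[symmetric])
  have tm: "(\<lambda>t. c' * left_translation x f t) \<in> borel_measurable borel" for c' x
    unfolding left_translation_def by measurable
  have tL: "(\<lambda>t. c' * left_translation x f t) \<in> weighted_Lp \<mu> p \<omega>" for c' x
  proof -
    have "wint UNIV 0 (\<lambda>t. c' * left_translation x f t) = ennreal (norm c' powr p) * wint UNIV x f"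
      using trans[of "\<lambda>_. 0" c' x] wint_cmult[of UNIV f x c'] by simp
    also have "\<dots> \<le> ennreal (norm c' powr p) * (ennreal (M x powr p) * wint UNIV 0 f)"
      by (intro mult_left_mono wint_left_le M) auto
    also have "\<dots> < \<infinity>" using f_fin by (simp add: ennreal_mult_less_top)
    finally show ?thesis using tm by (simp add: weighted_Lp_iff)
  qed
  have "dense_vector \<mu> p \<omega> \<Lambda> S f"
    unfolding dense_vector_def dense_in_weighted_Lp_iff
  proof (intro conjI ballI allI impI)
    show "f \<in> weighted_Lp \<mu> p \<omega>" using f_fin by (simp add: weighted_Lp_iff)
    show "{\<lambda>t. c * left_translation s f t |c s. c \<in> \<Lambda> \<and> s \<in> S} \<subseteq> weighted_Lp \<mu> p \<omega>" using tL by blast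
    fix u and \<epsilon> :: real assume u: "u \<in> weighted_Lp \<mu> p \<omega>" and e: "0 < \<epsilon>"
    have um [measurable]: "u \<in> borel_measurable borel" using u by (simp add: weighted_Lp_iff)
    define \<delta> where "\<delta> = \<epsilon> / (2 * 2 powr p)"
    have \<delta>: "0 < \<delta>" using e by (simp add: \<delta>_def)
    obtain d where d: "d \<in> D" "wint UNIV 0 (\<lambda>t. d t - u t) < ennreal \<delta>" using D(5)[OF u \<delta>] by blast
    have "(\<lambda>n. 2 powr p * 2 * (1 / 2) ^ n :: real) \<longlonglongrightarrow> 2 powr p * 2 * 0"
      by (intro tendsto_mult tendsto_const LIMSEQ_power_zero) auto
    then have "eventually (\<lambda>n. 2 powr p * 2 * (1 / 2) ^ n < \<delta>) sequentially"
      using order_tendstoD(2)[of _ "2 powr p * 2 * 0" sequentially \<delta>] \<delta> by simp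
    then obtain N where N: "\<And>n. n \<ge> N \<Longrightarrow> 2 powr p * 2 * (1 / 2) ^ n < \<delta>"
      unfolding eventually_sequentially by blast
    obtain n where n: "n \<ge> N" "g n = d" using g_inf[OF d(1)] by blast
    have "wint UNIV 0 (\<lambda>t. c n * left_translation (s n) f t - u t) \<le> ennreal (2 powr p) *
        (wint UNIV 0 (\<lambda>t. c n * left_translation (s n) f t - g n t) + wint UNIV 0 (\<lambda>t. g n t - u t))"
      using tm by (intro wint_diff_triangle) auto
    also have "wint UNIV 0 (\<lambda>t. c n * left_translation (s n) f t - g n t)
      \<le> ennreal (2 powr p * 2 * (1 / 2) ^ n)"
      using approx[of n] trans[OF gm] by simp
    also have "\<dots> \<le> ennreal \<delta>" using N[OF n(1)] by (intro ennreal_leI) simp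
    finally have "wint UNIV 0 (\<lambda>t. c n * left_translation (s n) f t - u t)
      \<le> ennreal (2 powr p) * (ennreal \<delta> + wint UNIV 0 (\<lambda>t. d t - u t))"
      by (simp add: n(2) mult_left_mono)
    also have "\<dots> < ennreal (2 powr p) * (ennreal \<delta> + ennreal \<delta>)"
      using d(2) by (intro ennreal_mult_strict_left_mono) auto
    also have "\<dots> = ennreal \<epsilon>" using \<delta>
      by (simp add: ennreal_mult'[symmetric] ennreal_plus[symmetric] \<delta>_def del: ennreal_plus)
    finally have close: "wint UNIV 0 (\<lambda>t. c n * left_translation (s n) f t - u t) < ennreal \<epsilon>" .
    show "\<exists>h\<in>{\<lambda>t. c * left_translation s f t |c s. c \<in> \<Lambda> \<and> s \<in> S}. wint UNIV 0 (\<lambda>t. h t - u t)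
      < ennreal \<epsilon>"
    proof (rule bexI[of _ "\<lambda>t. c n * left_translation (s n) f t"])
      show "wint UNIV 0 (\<lambda>t. c n * left_translation (s n) f t - u t) < ennreal \<epsilon>" by (rule close)
      show "(\<lambda>t. c n * left_translation (s n) f t) \<in>
        {\<lambda>t. c * left_translation s f t |c s. c \<in> \<Lambda> \<and> s \<in> S}"
        using sc(1)[of n] sc(2)[of n] by blast
    qed
  qed
  then show ?thesis by (rule exI[of _ f])
qed

end

section \<open>The four scalar sets\<close>

text \<open>For empty \<open>S\<close> the infimum is infinite, so both sides fail and the empty set
  needs no separate treatment.\<close>

lemma INF_ennreal_eq_0_iff:
  assumes "\<And>s. 0 \<le> h s"
  shows "(INF s\<in>S. ennreal (h s)) = 0 \<longleftrightarrow> (\<forall>\<epsilon>>0. \<exists>s\<in>S. h s < \<epsilon>)"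
proof
  assume 0: "(INF s\<in>S. ennreal (h s)) = 0"
  show "\<forall>\<epsilon>>0. \<exists>s\<in>S. h s < \<epsilon>"
  proof (intro allI impI)
    fix \<epsilon> :: real assume "0 < \<epsilon>"
    then have "(INF s\<in>S. ennreal (h s)) < ennreal \<epsilon>" using 0 by simp
    then show "\<exists>s\<in>S. h s < \<epsilon>" unfolding INF_less_iff using ennreal_less_iff[OF assms] by blast
  qed
next
  assume *: "\<forall>\<epsilon>>0. \<exists>s\<in>S. h s < \<epsilon>"
  have le: "(INF s\<in>S. ennreal (h s)) \<le> 0 + ennreal \<epsilon>" if "0 < \<epsilon>" for \<epsilon>
  proof -
    obtain s where "s \<in> S" "h s < \<epsilon>" using * \<open>0 < \<epsilon>\<close> by blast
    then show ?thesis by (intro INF_lower2[of s]) (auto intro: ennreal_leI)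
  qed
  have "(INF s\<in>S. ennreal (h s)) \<le> 0" by (rule ennreal_le_epsilon) (rule le)
  then show "(INF s\<in>S. ennreal (h s)) = 0" by simp
qed

lemma (in weighted_group) ex_dense_vector_iff:
  assumes "\<not> compact (UNIV :: 'a set)"
  shows "(\<exists>f. dense_vector \<mu> p \<omega> \<Lambda> S f) \<longleftrightarrow>
    (\<forall>\<epsilon>>0. \<exists>s\<in>S. \<exists>c\<in>\<Lambda>. norm c * \<omega> s < \<epsilon> \<and> \<omega> (- s) < \<epsilon> * norm c)"
  using dense_vector_necessary[OF assms] dense_vector_sufficient by blast

text \<open>Eliminates the scalar: positivity of \<open>b\<close> forces \<open>0 < r\<close>, and
  \<open>r\<close> cancels in the product of the two bounds.\<close>

lemma prod_less_of_scaled: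
  fixes a b r \<epsilon> :: real
  assumes "0 < a" "0 < b" "0 < \<epsilon>" "r * a < \<epsilon>" "b < \<epsilon> * r"
  shows "a * b < \<epsilon> * \<epsilon>"
proof -
  have r: "0 < r" using assms by (smt (verit) zero_less_mult_iff)
  have "a * b < a * (\<epsilon> * r)" using assms by simp
  also have "\<dots> = \<epsilon> * (r * a)" by simp
  also have "\<dots> < \<epsilon> * \<epsilon>" using assms by simp
  finally show ?thesis .
qed

text \<open>The admissible moduli form an open interval, nonempty exactly when
  \<open>a * b < \<epsilon> * \<epsilon>\<close>. Each scalar set then amounts to asking which part
  of this interval it meets.\<close>

lemma ex_scale_iff:
  fixes a b l u \<epsilon> :: real
  assumes "0 < a" "0 < \<epsilon>"
  shows "r * a < \<epsilon> \<and> b < \<epsilon> * r \<longleftrightarrow> b / \<epsilon> < r \<and> r < \<epsilon> / a"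
  using assms by (simp add: field_simps conj_commute)

theorem corollary5p5:
  fixes \<mu> :: "'a :: {topological_group_add, t2_space, second_countable_topology} measure"
    and S :: "'a set" and p :: real and \<Gamma> :: "complex set" and \<omega> :: "'a \<Rightarrow> real"
  assumes "locally_compact_space (euclidean :: 'a topology)"
    and "\<not> compact (UNIV :: 'a set)"
    and "left_haar_measure \<mu>"
    and "1 \<le> p"
    and "\<Gamma> - {0} \<noteq> {}"
    and "weight \<mu> \<omega>"
    and "locally_p_integrable \<mu> p \<omega>"
    and "admissible_weight \<mu> S \<omega>"
    and "continuous_on UNIV \<omega>"
    and "\<And>s. (SUP t. ennreal (\<omega> (s + t) / \<omega> t)) < \<infinity>"
    and "\<And>s. (SUP t. ennreal (\<omega> (t + s) / \<omega> t)) < \<infinity>"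
  shows "(bounded (\<Gamma> - {0}) \<and> (\<exists>c>0. \<forall>z\<in>\<Gamma> - {0}. c \<le> norm z) \<longrightarrow>
            ((\<exists>f. dense_vector \<mu> p \<omega> \<Gamma> S f) \<longleftrightarrow>
             (INF s\<in>S. ennreal (max (\<omega> s) (\<omega> (- s)))) = 0)) \<and>
         ((\<exists>f. dense_vector \<mu> p \<omega> (of_real ` {0..1}) S f) \<longleftrightarrow>
            (INF s\<in>S. ennreal (max (\<omega> s * \<omega> (- s)) (\<omega> (- s)))) = 0) \<and>
         ((\<exists>f. dense_vector \<mu> p \<omega> (of_real ` {1..}) S f) \<longleftrightarrow>
            (INF s\<in>S. ennreal (max (\<omega> s * \<omega> (- s)) (\<omega> s))) = 0) \<and>
         ((\<exists>f. dense_vector \<mu> p \<omega> UNIV S f) \<longleftrightarrow>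
            (INF s\<in>S. ennreal (\<omega> s * \<omega> (- s))) = 0)"
proof -
  have pos: "0 < \<omega> t" for t using assms(6) by (simp add: weight_def)
  have SUP_bound: "\<exists>C. \<forall>t. h t \<le> C * \<omega> t" if "(SUP t. ennreal (h t / \<omega> t)) < \<infinity>" for h :: "'a \<Rightarrow> real"
  proof -
    define C where "C = enn2real (SUP t. ennreal (h t / \<omega> t))"
    have C: "(SUP t. ennreal (h t / \<omega> t)) = ennreal C" "0 \<le> C" using that by (auto simp: C_def)
    have "h t \<le> C * \<omega> t" for t
    proof -
      have "ennreal (h t / \<omega> t) \<le> ennreal C" unfolding C(1)[symmetric] by (rule SUP_upper) simp
      then have "h t / \<omega> t \<le> C" using C(2) by (simp add: ennreal_le_iff)
      then show ?thesis using pos[of t] by (simp add: field_simps)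
    qed
    then show ?thesis by blast
  qed
  interpret weighted_group \<mu> p \<omega>
    by unfold_locales (use assms(1,3,4,9) pos SUP_bound[OF assms(10)] SUP_bound[OF assms(11)] in auto)
  note iff = ex_dense_vector_iff[OF assms(2)]
  have nn: "0 \<le> \<omega> s" "0 \<le> \<omega> s * \<omega> (- s)" for s using pos by (simp_all add: less_imp_le)
  have prod: "\<omega> s * \<omega> (- s) < \<epsilon> * \<epsilon>" if "0 < \<epsilon>" "r * \<omega> s < \<epsilon>" "\<omega> (- s) < \<epsilon> * r" for s r \<epsilon>
    using prod_less_of_scaled[OF pos pos] that by blast
  \<comment> \<open>Eliminating the scalar yields a product below
    \<open>\<delta> * \<delta>\<close>, which has to be at most \<epsilon>. For the converse,
    \<open>below\<close> supplies \<open>\<delta> \<le> \<epsilon> * \<epsilon>\<close>, so that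
    \<open>gap\<close> makes the interval of moduli nonempty.\<close>
  have sq: "\<exists>\<delta>>0. \<delta> \<le> \<epsilon> \<and> \<delta> * \<delta> \<le> \<epsilon>" if "0 < \<epsilon>" for \<epsilon> :: real
    using that mult_mono[of "min \<epsilon> 1" 1 "min \<epsilon> 1" \<epsilon>] by (intro exI[of _ "min \<epsilon> 1"]) auto
  have gap: "\<omega> (- s) / \<epsilon> < \<epsilon> / \<omega> s" if "0 < \<epsilon>" "\<omega> s * \<omega> (- s) < \<epsilon> * \<epsilon>" for s \<epsilon>
    using that pos[of s] by (simp add: field_simps)
  have below: "\<exists>\<delta>>0. \<delta> \<le> \<epsilon> \<and> \<delta> \<le> \<epsilon> * \<epsilon>" if "0 < \<epsilon>" for \<epsilon> :: real
    using that by (intro exI[of _ "min \<epsilon> (\<epsilon> * \<epsilon>)"]) auto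
  show ?thesis
  proof (intro conjI impI)
    assume \<Gamma>: "bounded (\<Gamma> - {0}) \<and> (\<exists>c>0. \<forall>z\<in>\<Gamma> - {0}. c \<le> norm z)"
    obtain m where m: "0 < m" "\<And>z. z \<in> \<Gamma> - {0} \<Longrightarrow> m \<le> norm z" using \<Gamma> by blast
    obtain M where M: "0 < M" "\<And>z. z \<in> \<Gamma> - {0} \<Longrightarrow> norm z \<le> M" using \<Gamma> unfolding bounded_pos by blast
    show "(\<exists>f. dense_vector \<mu> p \<omega> \<Gamma> S f) \<longleftrightarrow> (INF s\<in>S. ennreal (max (\<omega> s) (\<omega> (- s)))) = 0"
      unfolding iff INF_ennreal_eq_0_iff[of "\<lambda>s. max (\<omega> s) (\<omega> (- s))", OF max.coboundedI1[OF nn(1)]]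
    proof (intro iffI allI impI)
      fix \<epsilon> :: real
      assume *: "\<forall>\<epsilon>>0. \<exists>s\<in>S. \<exists>c\<in>\<Gamma>. norm c * \<omega> s < \<epsilon> \<and> \<omega> (- s) < \<epsilon> * norm c" and e: "0 < \<epsilon>"
      \<comment> \<open>The bounds \<open>m\<close> and \<open>M\<close> on the moduli absorb the
        scalar, one in each of the two inequalities.\<close>
      define \<delta> where "\<delta> = min (\<epsilon> * m) (\<epsilon> / M)"
      have \<delta>: "0 < \<delta>" "\<delta> \<le> \<epsilon> * m" "\<delta> \<le> \<epsilon> / M" using e m(1) M(1) by (auto simp: \<delta>_def)
      obtain s c where sc: "s \<in> S" "c \<in> \<Gamma>" "norm c * \<omega> s < \<delta>" "\<omega> (- s) < \<delta> * norm c" using * \<delta>(1)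
        by blast
      have "c \<noteq> 0" using sc(4) pos[of "- s"] by auto
      then have c: "m \<le> norm c" "norm c \<le> M" using sc(2) m M by auto
      have "m * \<omega> s \<le> norm c * \<omega> s" using c(1) nn(1) by (intro mult_right_mono)
      also have "\<dots> < \<epsilon> * m" using sc(3) \<delta>(2) by simp
      finally have "\<omega> s < \<epsilon>" using m(1) by (simp add: mult.commute)
      moreover have "\<delta> * norm c \<le> \<epsilon> / M * M" using \<delta> c e M(1) by (intro mult_mono) auto
      then have "\<omega> (- s) < \<epsilon>" using sc(4) M(1) by simp
      ultimately show "\<exists>s\<in>S. max (\<omega> s) (\<omega> (- s)) < \<epsilon>" using sc(1) by auto
    next
      fix \<epsilon> :: real
      assume *: "\<forall>\<epsilon>>0. \<exists>s\<in>S. max (\<omega> s) (\<omega> (- s)) < \<epsilon>" and e: "0 < \<epsilon>"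
      \<comment> \<open>One fixed nonzero scalar serves for all \<epsilon>.\<close>
      obtain c where c: "c \<in> \<Gamma>" "c \<noteq> 0" using assms(5) by blast
      then have "0 < min (\<epsilon> / norm c) (\<epsilon> * norm c)" using e by simp
      then obtain s where s: "s \<in> S" "max (\<omega> s) (\<omega> (- s)) < min (\<epsilon> / norm c) (\<epsilon> * norm c)" using *
        by blast
      then have "norm c * \<omega> s < \<epsilon>" "\<omega> (- s) < \<epsilon> * norm c" using c by (auto simp: field_simps)
      then show "\<exists>s\<in>S. \<exists>c\<in>\<Gamma>. norm c * \<omega> s < \<epsilon> \<and> \<omega> (- s) < \<epsilon> * norm c" using s c by blast
    qed
  next
    show "(\<exists>f. dense_vector \<mu> p \<omega> (of_real ` {0..1}) S f) \<longleftrightarrow>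
        (INF s\<in>S. ennreal (max (\<omega> s * \<omega> (- s)) (\<omega> (- s)))) = 0"
      unfolding iff INF_ennreal_eq_0_iff[of "\<lambda>s. max (\<omega> s * \<omega> (- s)) (\<omega> (- s))", OF
        max.coboundedI1[OF nn(2)]]
    proof (intro iffI allI impI)
      fix \<epsilon> :: real
      assume *: "\<forall>\<epsilon>>0. \<exists>s\<in>S. \<exists>c\<in>complex_of_real ` {0..1}. norm c * \<omega> s < \<epsilon> \<and> \<omega> (- s) < \<epsilon> * norm c"
        and e: "0 < \<epsilon>"
      obtain \<delta> where \<delta>: "0 < \<delta>" "\<delta> \<le> \<epsilon>" "\<delta> * \<delta> \<le> \<epsilon>" using sq[OF e] by blast
      obtain s r where s: "s \<in> S" "0 \<le> r" "r \<le> 1" "r * \<omega> s < \<delta>" "\<omega> (- s) < \<delta> * r"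
        using *[rule_format, OF \<delta>(1)] by auto
      have "\<delta> * r \<le> \<delta> * 1" using \<delta> s by (intro mult_left_mono) auto
      then have "\<omega> (- s) < \<epsilon>" using s(5) \<delta>(2) by linarith
      then have "max (\<omega> s * \<omega> (- s)) (\<omega> (- s)) < \<epsilon>" using prod[OF \<delta>(1) s(4,5)] \<delta> by auto
      then show "\<exists>s\<in>S. max (\<omega> s * \<omega> (- s)) (\<omega> (- s)) < \<epsilon>" using s(1) by blast
    next
      fix \<epsilon> :: real
      assume *: "\<forall>\<epsilon>>0. \<exists>s\<in>S. max (\<omega> s * \<omega> (- s)) (\<omega> (- s)) < \<epsilon>" and e: "0 < \<epsilon>"
      obtain \<delta> where \<delta>: "0 < \<delta>" "\<delta> \<le> \<epsilon>" "\<delta> \<le> \<epsilon> * \<epsilon>" using below[OF e] by blast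
      obtain s where s: "s \<in> S" "\<omega> s * \<omega> (- s) < \<epsilon> * \<epsilon>" "\<omega> (- s) < \<epsilon>" using *[rule_format, OF \<delta>(1)] \<delta>
        by auto
      \<comment> \<open>The bound on \<open>\<omega> (- s)\<close> puts the left end of the interval
        below 1, leaving room for a modulus under 1.\<close>
      have "\<omega> (- s) / \<epsilon> < min (\<epsilon> / \<omega> s) 1" using gap[OF e s(2)] s(3) e by simp
      then obtain r where r: "\<omega> (- s) / \<epsilon> < r" "r < min (\<epsilon> / \<omega> s) 1" using dense by blast
      moreover have "0 \<le> r" using r(1) nn(1)[of "- s"] e by (smt (verit) divide_nonneg_pos)
      ultimately have "complex_of_real r \<in> complex_of_real ` {0..1}"
        "norm (complex_of_real r) * \<omega> s < \<epsilon>"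
        "\<omega> (- s) < \<epsilon> * norm (complex_of_real r)"
        using ex_scale_iff[OF pos e, of r s "\<omega> (- s)"] by auto
      then show "\<exists>s\<in>S. \<exists>c\<in>complex_of_real ` {0..1}. norm c * \<omega> s < \<epsilon> \<and> \<omega> (- s) < \<epsilon> * norm c"
        using s(1) by blast
    qed
  next
    show "(\<exists>f. dense_vector \<mu> p \<omega> (of_real ` {1..}) S f) \<longleftrightarrow>
        (INF s\<in>S. ennreal (max (\<omega> s * \<omega> (- s)) (\<omega> s))) = 0"
      unfolding iff INF_ennreal_eq_0_iff[of "\<lambda>s. max (\<omega> s * \<omega> (- s)) (\<omega> s)", OF
        max.coboundedI1[OF nn(2)]]
    proof (intro iffI allI impI)
      fix \<epsilon> :: real
      assume *: "\<forall>\<epsilon>>0. \<exists>s\<in>S. \<exists>c\<in>complex_of_real ` {1..}. norm c * \<omega> s < \<epsilon> \<and> \<omega> (- s) < \<epsilon> * norm c"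
        and e: "0 < \<epsilon>"
      obtain \<delta> where \<delta>: "0 < \<delta>" "\<delta> \<le> \<epsilon>" "\<delta> * \<delta> \<le> \<epsilon>" using sq[OF e] by blast
      obtain s r where s: "s \<in> S" "1 \<le> r" "r * \<omega> s < \<delta>" "\<omega> (- s) < \<delta> * r"
        using *[rule_format, OF \<delta>(1)] by auto
      have "1 * \<omega> s \<le> r * \<omega> s" using s nn(1) by (intro mult_right_mono) auto
      then have "max (\<omega> s * \<omega> (- s)) (\<omega> s) < \<epsilon>" using prod[OF \<delta>(1) s(3,4)] \<delta> s by auto
      then show "\<exists>s\<in>S. max (\<omega> s * \<omega> (- s)) (\<omega> s) < \<epsilon>" using s(1) by blast
    next
      fix \<epsilon> :: real
      assume *: "\<forall>\<epsilon>>0. \<exists>s\<in>S. max (\<omega> s * \<omega> (- s)) (\<omega> s) < \<epsilon>" and e: "0 < \<epsilon>"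
      obtain \<delta> where \<delta>: "0 < \<delta>" "\<delta> \<le> \<epsilon>" "\<delta> \<le> \<epsilon> * \<epsilon>" using below[OF e] by blast
      obtain s where s: "s \<in> S" "\<omega> s * \<omega> (- s) < \<epsilon> * \<epsilon>" "\<omega> s < \<epsilon>" using *[rule_format, OF \<delta>(1)] \<delta>
        by auto
      \<comment> \<open>Dually, the bound on \<open>\<omega> s\<close> puts the right end of the
        interval above 1.\<close>
      have "max (\<omega> (- s) / \<epsilon>) 1 < \<epsilon> / \<omega> s" using gap[OF e s(2)] s(3) pos[of s] by simp
      then obtain r where r: "max (\<omega> (- s) / \<epsilon>) 1 < r" "r < \<epsilon> / \<omega> s" using dense by blast
      then have "complex_of_real r \<in> complex_of_real ` {1..}" "norm (complex_of_real r) * \<omega> s < \<epsilon>"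
        "\<omega> (- s) < \<epsilon> * norm (complex_of_real r)"
        using ex_scale_iff[OF pos e, of r s "\<omega> (- s)"] by auto
      then show "\<exists>s\<in>S. \<exists>c\<in>complex_of_real ` {1..}. norm c * \<omega> s < \<epsilon> \<and> \<omega> (- s) < \<epsilon> * norm c" using s(1)
        by blast
    qed
  next
    show "(\<exists>f. dense_vector \<mu> p \<omega> UNIV S f) \<longleftrightarrow> (INF s\<in>S. ennreal (\<omega> s * \<omega> (- s))) = 0"
      unfolding iff INF_ennreal_eq_0_iff[of "\<lambda>s. \<omega> s * \<omega> (- s)", OF nn(2)]
    proof (intro iffI allI impI)
      fix \<epsilon> :: real
      assume *: "\<forall>\<epsilon>>0. \<exists>s\<in>S. \<exists>c\<in>(UNIV :: complex set). norm c * \<omega> s < \<epsilon> \<and> \<omega> (- s) < \<epsilon> * norm c"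
        and e: "0 < \<epsilon>"
      obtain \<delta> where \<delta>: "0 < \<delta>" "\<delta> \<le> \<epsilon>" "\<delta> * \<delta> \<le> \<epsilon>" using sq[OF e] by blast
      obtain s c where s: "s \<in> S" "norm (c :: complex) * \<omega> s < \<delta>" "\<omega> (- s) < \<delta> * norm c"
        using *[rule_format, OF \<delta>(1)] by auto
      then show "\<exists>s\<in>S. \<omega> s * \<omega> (- s) < \<epsilon>" using prod[OF \<delta>(1) s(2,3)] \<delta> by force
    next
      fix \<epsilon> :: real
      assume *: "\<forall>\<epsilon>>0. \<exists>s\<in>S. \<omega> s * \<omega> (- s) < \<epsilon>" and e: "0 < \<epsilon>"
      then obtain s where s: "s \<in> S" "\<omega> s * \<omega> (- s) < \<epsilon> * \<epsilon>" by (metis mult_pos_pos)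
      obtain r where r: "\<omega> (- s) / \<epsilon> < r" "r < \<epsilon> / \<omega> s" using gap[OF e s(2)] dense by blast
      moreover have "0 \<le> r" using r(1) nn(1)[of "- s"] e by (smt (verit) divide_nonneg_pos)
      ultimately have "norm (complex_of_real r) * \<omega> s < \<epsilon>" "\<omega> (- s) < \<epsilon> * norm (complex_of_real r)"
        using ex_scale_iff[OF pos e, of r s "\<omega> (- s)"] by auto
      then show "\<exists>s\<in>S. \<exists>c\<in>(UNIV :: complex set). norm c * \<omega> s < \<epsilon> \<and> \<omega> (- s) < \<epsilon> * norm c" using s(1)
        by blast
    qed
  qed
qed

end
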